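(* For every positive integer $d$, let $N(d)$ be the minimal positive integer $N$ such that the polynomial $J_p^{d,n}(X) := \sum_{j=0}^{d} \binom{d}{j} p(n+j) X^j$ is hyperbolic for all $n \geq N$, where $p(n)$ is the number of integer partitions of $n$. Then $N(d) \leq (3d)^{24d}(50d)^{3d^2}$.
   Context: A real polynomial is called hyperbolic if all of its zeros are real. It is known that for each $d$ the polynomials $J_p^{d,n}(X)$ are hyperbolic for all sufficiently large $n$, so $N(d)$ is well defined. *)

theory Defs
  imports
    Complex_Main
    "HOL-Library.Multiset"
    "HOL-Computational_Algebra.Polynomial"
begin

text \<open>A partition of \<open>n\<close> is a multiset of positive integers with sum \<open>n\<close>; in particular
  the empty multiset is the only partition of \<open>0\<close>.\<close>

definition partitions :: "nat \<Rightarrow> nat multiset set" where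
  "partitions n = {M. 0 \<notin># M \<and> sum_mset M = n}"

definition partition_count :: "nat \<Rightarrow> nat" where
  "partition_count n = card (partitions n)"

text \<open>\<^const>\<open>card\<close> is \<open>0\<close> on infinite sets; the next lemma shows that this convention plays
  no role in \<^const>\<open>partition_count\<close>.\<close>

lemma finite_partitions: "finite (partitions n)"
proof -
  have size_le: "size M \<le> sum_mset M" if "0 \<notin># M" for M :: "nat multiset"
    using that by (induction M) auto
  have "partitions n \<subseteq> mset ` {xs. set xs \<subseteq> {..n} \<and> length xs \<le> n}"
  proof
    fix M assume "M \<in> partitions n"
    then have M: "0 \<notin># M" "sum_mset M = n"
      by (auto simp: partitions_def)
    obtain xs where xs: "M = mset xs"
      by (metis ex_mset)
    have "set xs \<subseteq> {..n}"
      using M xs by (auto simp: sum_mset_sum_list member_le_sum_list)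
    moreover have "length xs \<le> n"
      using size_le[of M] M xs by simp
    ultimately show "M \<in> mset ` {xs. set xs \<subseteq> {..n} \<and> length xs \<le> n}"
      using xs by blast
  qed
  then show ?thesis
    by (rule finite_subset) (simp add: finite_lists_length_le)
qed

definition jensen_poly :: "nat \<Rightarrow> nat \<Rightarrow> real poly" where
  "jensen_poly d n = (\<Sum>j=0..d. monom (real (d choose j) * real (partition_count (n + j))) j)"

text \<open>The zeros of a real polynomial are its zeros in the complex plane.\<close>

definition hyperbolic :: "real poly \<Rightarrow> bool" where
  "hyperbolic q \<longleftrightarrow> (\<forall>z::complex. poly (map_poly complex_of_real q) z = 0 \<longrightarrow> z \<in> \<real>)"

text \<open>\<^const>\<open>Least\<close> is unspecified when no such \<open>N\<close> exists, so a bound on \<open>hyperbolicity_bound d\<close>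
  can only be derived together with the existence of some admissible \<open>N\<close>.\<close>

definition hyperbolicity_bound :: "nat \<Rightarrow> nat" where
  "hyperbolicity_bound d = (LEAST N. 0 < N \<and> (\<forall>n\<ge>N. hyperbolic (jensen_poly d n)))"

end

theory Submission
  imports
    Defs
    "HOL-Probability.Probability"
    "HOL-Real_Asymp.Real_Asymp"
begin

text \<open>
  With \<open>N = n + d\<close>, only parts of size at most \<open>N\<close> matter, so the generating function may be
  replaced by the finite product \<open>F(q) = (\<Prod>k=1..N. 1 / (1 - q^k))\<close>, and Cauchy's formula turns the Jensen
  polynomial into \<open>2 \<pi> J(X) = \<integral> F(q) q^-N (X + q)^d d\<theta>\<close> over the circle \<open>q = r e^(i \<theta>)\<close>. Choose the
  saddle point \<open>r = e^-t\<close>, where the logarithmic derivative \<open>r F'(r) / F(r)\<close> equals \<open>N\<close>, let \<open>1 / \<delta>^2\<close> be the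
  corresponding variance, and put \<open>X = - r (1 - s \<delta>)\<close>, \<open>\<theta> = \<delta> y\<close>. Then the integral is a
  positive multiple of \<open>\<integral> e^(-y^2/2) (s + i y)^d dy + o(1) = \<surd>(2 \<pi>) He_d(s) + o(1)\<close>: since the factor
  \<open>(s + i y)^d\<close> carries the cancellation exactly, only orders of magnitude of the first three
  cumulants of \<open>F\<close> are needed, and no asymptotic formula for the partition function.

  By the confluent Christoffel--Darboux identity the values of \<open>He_d\<close> at the \<open>d + 1\<close> zeros of
  \<open>He_(d+1)\<close> alternate in sign and have absolute value at least \<open>1/2\<close>. Hence \<open>J\<close> changes sign \<open>d\<close> times.
\<close>

section \<open>The generating function of partitions with bounded parts\<close>

text \<open>The obstacle is uniformity in d. On the scaled integral the error has order D^-6, where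
  t = D^-16 and N has order t^-2, that is D^32. It is multiplied by a factor of size ((d + 2) (d +
  3))^(d + 3), the price of bounding (s + i y)^d and the error weights for |s| <= d + 1. Keeping the
  total below half of sqrt (2 pi) therefore asks for N of order ((d + 2) (d + 3))^(16 (d + 3) / 3).
  The stated threshold has d^2 in its exponent, so for large d there is ample room, and crude
  rational constants suffice everywhere. The numerical comparison matters for small d only; d = 1
  lies outside its range but concerns a linear polynomial.

  Only a sign count is needed, not an approximation of the zeros: d + 1 alternating values of a
  polynomial of degree at most d already give d distinct real zeros and leave no room for
  others.\<close>

definition bounded_partitions :: "nat \<Rightarrow> nat \<Rightarrow> nat multiset set" where
  "bounded_partitions N m = {M. set_mset M \<subseteq> {1..N} \<and> sum_mset M = m}"

definition bounded_partition_count :: "nat \<Rightarrow> nat \<Rightarrow> nat" where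
  "bounded_partition_count N m = card (bounded_partitions N m)"

lemma bounded_partitions_subset: "bounded_partitions N m \<subseteq> partitions m"
  by (auto simp: bounded_partitions_def partitions_def)

lemma finite_bounded_partitions: "finite (bounded_partitions N m)"
  using finite_subset[OF bounded_partitions_subset finite_partitions] .

lemma bounded_partition_count_eq:
  assumes "m \<le> N"
  shows "bounded_partition_count N m = partition_count m"
proof -
  have "x \<le> sum_mset M" if "x \<in># M" for x :: nat and M
    using that by (auto dest!: multi_member_split)
  then have *: "x \<le> N" if "x \<in># M" "sum_mset M = m" for x M
    using that assms le_trans by blast
  have "partitions m \<subseteq> bounded_partitions N m"
  proof
    fix M assume M: "M \<in> partitions m"
    have "1 \<le> x \<and> x \<le> N" if "x \<in># M" for x
      using that M * by (cases "x = 0") (auto simp: partitions_def)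
    then show "M \<in> bounded_partitions N m"
      using M by (auto simp: bounded_partitions_def partitions_def)
  qed
  then have "bounded_partitions N m = partitions m"
    using bounded_partitions_subset by blast
  then show ?thesis
    by (simp add: bounded_partition_count_def partition_count_def)
qed

lemma bounded_partition_count_0: "bounded_partition_count 0 m = (if m = 0 then 1 else 0)"
proof -
  have "bounded_partitions 0 m = (if m = 0 then {{#}} else {})"
    by (auto simp: bounded_partitions_def)
  then show ?thesis
    by (simp add: bounded_partition_count_def)
qed

text \<open>Partitions are split by whether the part N + 1 occurs. Deleting one copy of it leaves a
  partition that may use N + 1 again, so the recursive call keeps \<open>Suc N\<close>. In terms of
  series this is (1 - q^(N+1)) F_(N+1) = F_N.\<close>

lemma bounded_partition_count_Suc:
  "bounded_partition_count (Suc N) m = bounded_partition_count N m +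
     (if Suc N \<le> m then bounded_partition_count (Suc N) (m - Suc N) else 0)"
proof -
  define A where "A = {M \<in> bounded_partitions (Suc N) m. Suc N \<in># M}"
  have split: "bounded_partitions (Suc N) m = bounded_partitions N m \<union> A"
  proof (intro equalityI subsetI)
    fix M assume M: "M \<in> bounded_partitions (Suc N) m"
    show "M \<in> bounded_partitions N m \<union> A"
    proof (cases "Suc N \<in># M")
      case False
      then have "set_mset M \<subseteq> {1..Suc N} - {Suc N}"
        using M by (auto simp only: bounded_partitions_def)
      also have "{1..Suc N} - {Suc N} = {1..N}"
        by auto
      finally show ?thesis
        using M by (auto simp only: bounded_partitions_def)
    qed (use M in \<open>simp add: A_def\<close>)
  next
    fix M assume "M \<in> bounded_partitions N m \<union> A"
    moreover have "{1..N} \<subseteq> {1..Suc N}"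
      by auto
    ultimately show "M \<in> bounded_partitions (Suc N) m"
      unfolding A_def bounded_partitions_def by blast
  qed
  have "Suc N \<notin># M" if "M \<in> bounded_partitions N m" for M
    using that by (auto simp only: bounded_partitions_def mem_Collect_eq subset_iff atLeastAtMost_iff)
  then have disj: "bounded_partitions N m \<inter> A = {}"
    unfolding A_def by blast
  have fin: "finite A"
    unfolding A_def by (intro finite_Collect_conjI disjI1) (simp add: finite_bounded_partitions)
  have "A = (if Suc N \<le> m then add_mset (Suc N) ` bounded_partitions (Suc N) (m - Suc N) else {})"
    (is "A = ?B")
  proof (rule set_eqI)
    fix M
    show "M \<in> A \<longleftrightarrow> M \<in> ?B"
    proof
      assume M: "M \<in> A"
      then have "Suc N \<in># M"
        by (simp add: A_def)
      then obtain M' where M': "M = add_mset (Suc N) M'"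
        using multi_member_split[of "Suc N" M] by metis
      have "set_mset M \<subseteq> {1..Suc N}" "sum_mset M = m"
        using M by (auto simp only: A_def bounded_partitions_def mem_Collect_eq)
      then have "Suc N \<le> m" "M' \<in> bounded_partitions (Suc N) (m - Suc N)"
        unfolding M' bounded_partitions_def by auto
      then show "M \<in> ?B"
        using M' by simp
    next
      assume "M \<in> ?B"
      then obtain M' where "M = add_mset (Suc N) M'" "Suc N \<le> m"
          "M' \<in> bounded_partitions (Suc N) (m - Suc N)"
        by (cases "Suc N \<le> m") auto
      then show "M \<in> A"
        by (auto simp: A_def bounded_partitions_def)
    qed
  qed
  then have "card A = (if Suc N \<le> m then bounded_partition_count (Suc N) (m - Suc N) else 0)"
    by (simp add: bounded_partition_count_def card_image inj_on_def)
  moreover have "card (bounded_partitions N m \<union> A) = card (bounded_partitions N m) + card A"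
    by (intro card_Un_disjoint finite_bounded_partitions disj fin)
  ultimately show ?thesis
    by (simp only: bounded_partition_count_def split)
qed

text \<open>The functional equation cannot be used before convergence is known, so it is applied to
  partial sums: A_M <= B + x^(N+1) A_M, with B the full sum for N, bounds A_M by B / (1 -
  x^(N+1)).\<close>

lemma summable_bounded_partition_count:
  fixes x :: real
  assumes x: "0 \<le> x" "x < 1"
  shows "summable (\<lambda>m. real (bounded_partition_count N m) * x ^ m)"
proof (induction N)
  case 0
  have "summable (\<lambda>m. if m = 0 then 1 else (0::real))"
    by simp
  then show ?case
    by (rule back_subst[of summable]) (simp add: bounded_partition_count_0 fun_eq_iff)
next
  case (Suc N)
  let ?a = "\<lambda>m. real (bounded_partition_count (Suc N) m) * x ^ m"
  let ?b = "\<lambda>m. real (bounded_partition_count N m) * x ^ m"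
  have y: "0 \<le> x ^ Suc N" "x ^ Suc N < 1"
    using x by (auto simp: power_less_one_iff simp del: power_Suc)
  have nn: "0 \<le> ?a m" "0 \<le> ?b m" for m
    using x by auto
  have bound: "(\<Sum>m<M. ?a m) \<le> (\<Sum>m. ?b m) / (1 - x ^ Suc N)" for M
  proof -
    have "?a m = ?b m + (if Suc N \<le> m then x ^ Suc N * ?a (m - Suc N) else 0)" for m
    proof (cases "Suc N \<le> m")
      case True
      then obtain k where "m = Suc N + k"
        using le_Suc_ex by blast
      then show ?thesis
        using bounded_partition_count_Suc[of N m] by (simp add: power_add distrib_right)
    next
      case False
      then show ?thesis
        using bounded_partition_count_Suc[of N m] by simp
    qed
    then have "(\<Sum>m<M. ?a m) = (\<Sum>m<M. ?b m) +
        (\<Sum>m<M. if Suc N \<le> m then x ^ Suc N * ?a (m - Suc N) else 0)"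
      unfolding sum.distrib[symmetric] by (intro sum.cong refl)
    also have "(\<Sum>m<M. if Suc N \<le> m then x ^ Suc N * ?a (m - Suc N) else 0) =
        (\<Sum>m\<in>{Suc N..<M}. x ^ Suc N * ?a (m - Suc N))"
      by (rule sum.mono_neutral_cong_right) auto
    also have "\<dots> = (\<Sum>m\<in>{..<M - Suc N}. x ^ Suc N * ?a m)"
      by (rule sum.reindex_bij_witness[of _ "\<lambda>i. i + Suc N" "\<lambda>i. i - Suc N"]) auto
    also have "\<dots> = x ^ Suc N * (\<Sum>m\<in>{..<M - Suc N}. ?a m)"
      by (rule sum_distrib_left[symmetric])
    also have "\<dots> \<le> x ^ Suc N * (\<Sum>m<M. ?a m)"
      by (intro mult_left_mono sum_mono2 y nn) auto
    also have "(\<Sum>m<M. ?b m) \<le> (\<Sum>m. ?b m)"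
      by (rule sum_le_suminf[OF Suc.IH]) (use nn in auto)
    finally have "(\<Sum>m<M. ?a m) * (1 - x ^ Suc N) \<le> (\<Sum>m. ?b m)"
      by (simp only: right_diff_distrib mult_1_right mult.commute[of "x ^ Suc N"])
         linarith
    then show ?thesis
      using y by (simp only: pos_le_divide_eq diff_gt_0_iff_gt)
  qed
  show ?case
    by (rule summableI_nonneg_bounded[OF nn(1) bound])
qed

lemma summable_norm_bounded_partition_count:
  fixes q :: complex
  assumes "norm q < 1"
  shows "summable (\<lambda>m. norm (of_nat (bounded_partition_count N m) * q ^ m))"
  using summable_bounded_partition_count[of "norm q" N] assms
  by (simp add: norm_mult norm_power)

text \<open>With convergence available, the recursion becomes S = F_N + q^(N+1) S for the sum S and
  is solved for S.\<close>

lemma bounded_partition_count_sums: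
  fixes q :: complex
  assumes q: "norm q < 1"
  shows "(\<lambda>m. of_nat (bounded_partition_count N m) * q ^ m) sums (\<Prod>k=1..N. 1 / (1 - q ^ k))"
proof (induction N)
  case 0
  have "(\<lambda>m. of_nat (bounded_partition_count 0 m) * q ^ m) = (\<lambda>m. if m = 0 then 1 else 0)"
    by (auto simp: bounded_partition_count_0)
  then show ?case
    using sums_single[of 0 "\<lambda>_. 1::complex"] by simp
next
  case (Suc N)
  let ?a = "\<lambda>m. of_nat (bounded_partition_count (Suc N) m) * q ^ m"
  let ?b = "\<lambda>m. of_nat (bounded_partition_count N m) * q ^ m"
  define S where "S = (\<Sum>m. ?a m)"
  have a: "?a sums S"
    unfolding S_def using summable_norm_cancel[OF summable_norm_bounded_partition_count[OF q]]
    by (rule summable_sums)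
  have "(\<lambda>m. if Suc N \<le> m then q ^ Suc N * ?a (m - Suc N) else 0) sums (q ^ Suc N * S)"
    (is "?c sums _")
  proof -
    have "(\<lambda>m. ?c (m + Suc N)) sums (q ^ Suc N * S)"
      using sums_mult[OF a, of "q ^ Suc N"] by (simp del: power_Suc)
    moreover have "(\<Sum>m<Suc N. ?c m) = 0"
      by (rule sum.neutral) auto
    ultimately show ?thesis
      by (subst (asm) sums_iff_shift) simp
  qed
  then have "(\<lambda>m. ?b m + ?c m) sums ((\<Prod>k=1..N. 1 / (1 - q ^ k)) + q ^ Suc N * S)"
    by (rule sums_add[OF Suc.IH])
  also have "(\<lambda>m. ?b m + ?c m) = ?a"
  proof
    fix m show "?b m + ?c m = ?a m"
    proof (cases "Suc N \<le> m")
      case True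
      then obtain k where "m = Suc N + k"
        using le_Suc_ex by blast
      then show ?thesis
        using bounded_partition_count_Suc[of N m] by (simp add: power_add distrib_right)
    next
      case False
      then show ?thesis
        using bounded_partition_count_Suc[of N m] by simp
    qed
  qed
  finally have S: "S = (\<Prod>k=1..N. 1 / (1 - q ^ k)) + q ^ Suc N * S"
    by (rule sums_unique2[OF a])
  have ne: "q ^ Suc N \<noteq> 1"
  proof
    assume "q ^ Suc N = 1"
    then have "norm q ^ Suc N = 1"
      by (metis norm_one norm_power)
    moreover have "norm q ^ Suc N < 1"
      using q by (auto simp: power_less_one_iff simp del: power_Suc)
    ultimately show False
      by simp
  qed
  from S have "S - q ^ Suc N * S = (\<Prod>k=1..N. 1 / (1 - q ^ k))"
    by (simp only: diff_eq_eq)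
  then have "S * (1 - q ^ Suc N) = (\<Prod>k=1..N. 1 / (1 - q ^ k))"
    by (simp only: right_diff_distrib mult_1_right mult.commute[of S])
  moreover have "1 - q ^ Suc N \<noteq> 0"
    using ne by (simp del: power_Suc)
  ultimately have "S = (\<Prod>k=1..Suc N. 1 / (1 - q ^ k))"
    by (simp add: eq_divide_eq del: power_Suc)
  then show ?case
    using a by simp
qed

section \<open>Extraction of coefficients on a circle\<close>

lemma integral_cis_int:
  fixes m :: int
  shows "(LBINT x:{-pi..pi}. cis (of_int m * x)) = (if m = 0 then of_real (2 * pi) else 0)"
proof (cases "m = 0")
  case True
  then show ?thesis
    by (simp add: set_lebesgue_integral_def scaleR_conv_of_real)
next
  case False
  have "(LBINT x:{-pi..pi}. cis (of_int m * x)) =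
     cis (of_int m * pi) / (\<i> * of_int m) - cis (of_int m * - pi) / (\<i> * of_int m)"
    unfolding set_lebesgue_integral_def
  proof (rule integral_FTC_atLeastAtMost)
    fix x :: real
    have "((\<lambda>z. exp (\<i> * of_int m * z) / (\<i> * of_int m)) has_field_derivative
        exp (\<i> * of_int m * of_real x)) (at (of_real x))"
      using False by (auto intro!: derivative_eq_intros)
    then have "((\<lambda>x. exp (\<i> * of_int m * of_real x) / (\<i> * of_int m)) has_vector_derivative
        exp (\<i> * of_int m * of_real x)) (at x within {-pi..pi})"
      by (rule has_vector_derivative_real_field)
    then show "((\<lambda>x. cis (of_int m * x) / (\<i> * of_int m)) has_vector_derivative
        cis (of_int m * x)) (at x within {-pi..pi})"
      by (simp add: cis_conv_exp mult_ac)
  qed (auto intro!: continuous_intros)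
  also have "cis (of_int m * pi) = cis (of_int m * - pi)"
    unfolding cis_conv_exp by (subst exp_eq) (auto intro!: exI[of _ m])
  finally show ?thesis
    using False by simp
qed

lemma rcis_power_divide:
  assumes "r \<noteq> 0"
  shows "rcis r x ^ m / rcis r x ^ n = of_real (r ^ m / r ^ n) * cis (of_int (int m - int n) * x)"
proof -
  have "cis (of_int (int m - int n) * x) = cis x ^ m / cis x ^ n"
    by (simp only: Complex.DeMoivre cis_divide of_int_diff of_int_of_nat_eq left_diff_distrib)
  then show ?thesis
    by (simp add: rcis_def power_mult_distrib)
qed

text \<open>Cauchy's formula in real-variable form: absolute summability at radius r permits
  term-by-term integration, and by orthogonality only the term m = n survives.\<close>

lemma Fourier_coefficient:
  fixes a :: "nat \<Rightarrow> complex"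
  assumes r: "0 < r" and summable: "summable (\<lambda>m. norm (a m) * r ^ m)"
    and f: "\<And>x. (\<lambda>m. a m * rcis r x ^ m) sums f x"
  shows "(LBINT x:{-pi..pi}. f x / rcis r x ^ n) = of_real (2 * pi) * a n"
proof -
  define g where "g = (\<lambda>m x. indicator {-pi..pi} x *\<^sub>R (a m * (rcis r x ^ m / rcis r x ^ n)))"
  have g: "g m = (\<lambda>x. a m * of_real (r ^ m / r ^ n) * (indicator {-pi..pi} x *\<^sub>R cis (of_int (int m - int n) * x)))" for m
    using r by (simp add: g_def rcis_power_divide fun_eq_iff)
  have int: "integrable lborel (\<lambda>x. indicator {-pi..pi} x *\<^sub>R cis (of_int k * x))" for k
    by (intro borel_integrable_atLeastAtMost'[unfolded set_integrable_def] continuous_intros)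
  have norm_g: "norm (g m x) = norm (a m) * r ^ m * (indicator {-pi..pi} x / r ^ n)" for m x
    using r by (simp add: g norm_mult norm_power norm_divide)
  have "(\<lambda>m. integral\<^sup>L lborel (g m)) sums (\<integral>x. (\<Sum>m. g m x) \<partial>lborel)"
  proof (rule sums_integral)
    show "integrable lborel (g m)" for m
      unfolding g by (intro integrable_mult_right int)
    show "AE x in lborel. summable (\<lambda>m. norm (g m x))"
      unfolding norm_g by (intro always_eventually allI summable_mult2 summable)
    have "(\<integral>x. norm (g m x) \<partial>lborel) = norm (a m) * r ^ m * (2 * pi / r ^ n)" for m
      unfolding norm_g by simp
    then show "summable (\<lambda>m. \<integral>x. norm (g m x) \<partial>lborel)"
      by (simp only: summable_mult2 summable)
  qed
  moreover have "(\<integral>x. (\<Sum>m. g m x) \<partial>lborel) = (LBINT x:{-pi..pi}. f x / rcis r x ^ n)"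
    unfolding set_lebesgue_integral_def
  proof (intro Bochner_Integration.integral_cong refl)
    fix x
    have "(\<lambda>m. g m x) sums (indicator {-pi..pi} x *\<^sub>R (f x / rcis r x ^ n))"
      unfolding g_def using sums_scaleR_right[OF sums_divide[OF f]] by simp
    then show "(\<Sum>m. g m x) = indicator {-pi..pi} x *\<^sub>R (f x / rcis r x ^ n)"
      by (rule sums_unique[symmetric])
  qed
  moreover have "(\<lambda>m. integral\<^sup>L lborel (g m)) = (\<lambda>m. if m = n then of_real (2 * pi) * a m else 0)"
  proof
    fix m
    have "integral\<^sup>L lborel (g m) = a m * of_real (r ^ m / r ^ n) * (LBINT x:{-pi..pi}. cis (of_int (int m - int n) * x))"
      unfolding g set_lebesgue_integral_def by (rule integral_mult_right_zero)
    then show "integral\<^sup>L lborel (g m) = (if m = n then of_real (2 * pi) * a m else 0)"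
      unfolding integral_cis_int using r by (simp split: if_splits)
  qed
  ultimately show ?thesis
    using sums_unique2 sums_single by metis
qed

definition partition_gf :: "nat \<Rightarrow> complex \<Rightarrow> complex" where
  "partition_gf N q = (\<Prod>k=1..N. 1 / (1 - q ^ k))"

lemma one_minus_power_nonzero:
  fixes q :: complex
  assumes "norm q < 1" "0 < k"
  shows "1 - q ^ k \<noteq> 0"
proof
  assume "1 - q ^ k = 0"
  then have "norm q ^ k = 1"
    by (metis eq_iff_diff_eq_0 norm_one norm_power)
  then show False
    using assms power_less_one_iff[of "norm q" k] by simp
qed

lemma continuous_on_partition_gf_rcis:
  assumes "0 < r" "r < 1"
  shows "continuous_on S (\<lambda>x. partition_gf N (rcis r x))"
  unfolding partition_gf_def rcis_def
  using one_minus_power_nonzero assms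
  by (intro continuous_intros ballI) (auto simp: norm_mult)

text \<open>Extracting the coefficients with exponents \<open>n + j\<close> gives
  \<open>(\<Sum>j. (d choose j) X^j q^-(n + j)) = (X + q)^d q^-(n + d)\<close>, so the upper end \<open>n + d\<close> is the natural
  exponent to centre the saddle point at.\<close>

lemma jensen_poly_eq_integral:
  assumes r: "0 < r" "r < 1"
  shows "(LBINT x:{-pi..pi}. partition_gf (n + d) (rcis r x) * (of_real X + rcis r x) ^ d / rcis r x ^ (n + d))
     = of_real (2 * pi * poly (jensen_poly d n) X)"
proof -
  let ?F = "\<lambda>x. partition_gf (n + d) (rcis r x)"
  have coeff: "(LBINT x:{-pi..pi}. ?F x / rcis r x ^ (n + j)) = of_real (2 * pi * partition_count (n + j))"
    if "j \<le> d" for j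
  proof -
    have "(LBINT x:{-pi..pi}. ?F x / rcis r x ^ (n + j)) =
        of_real (2 * pi) * of_nat (bounded_partition_count (n + d) (n + j))"
    proof (rule Fourier_coefficient[OF r(1)])
      show "summable (\<lambda>m. norm (complex_of_nat (bounded_partition_count (n + d) m)) * r ^ m)"
        using summable_bounded_partition_count[of r] r by simp
      show "(\<lambda>m. of_nat (bounded_partition_count (n + d) m) * rcis r x ^ m) sums ?F x" for x
        unfolding partition_gf_def using r by (intro bounded_partition_count_sums) simp
    qed
    then show ?thesis
      using that by (simp add: bounded_partition_count_eq)
  qed
  have ne: "rcis r x \<noteq> 0" for x
    using r by simp
  have "?F x * (of_real X + rcis r x) ^ d / rcis r x ^ (n + d) =
      (\<Sum>j\<le>d. of_real (real (d choose j) * X ^ j) * (?F x / rcis r x ^ (n + j)))" for x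
  proof -
    have "?F x * (of_real X + rcis r x) ^ d / rcis r x ^ (n + d) =
       (\<Sum>j\<le>d. ?F x * (of_nat (d choose j) * of_real X ^ j * rcis r x ^ (d - j)) / rcis r x ^ (n + d))"
      by (simp add: binomial_ring sum_distrib_left sum_divide_distrib)
    also have "\<dots> = (\<Sum>j\<le>d. of_real (real (d choose j) * X ^ j) * (?F x / rcis r x ^ (n + j)))"
    proof (rule sum.cong[OF refl])
      fix j assume "j \<in> {..d}"
      then have "rcis r x ^ (n + d) = rcis r x ^ (n + j) * rcis r x ^ (d - j)"
        by (simp flip: power_add)
      then show "?F x * (of_nat (d choose j) * of_real X ^ j * rcis r x ^ (d - j)) / rcis r x ^ (n + d) =
          of_real (real (d choose j) * X ^ j) * (?F x / rcis r x ^ (n + j))"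
        using ne[of x] by (simp add: field_simps)
    qed
    finally show ?thesis .
  qed
  then have "(LBINT x:{-pi..pi}. ?F x * (of_real X + rcis r x) ^ d / rcis r x ^ (n + d)) =
     (LBINT x:{-pi..pi}. (\<Sum>j\<le>d. of_real (real (d choose j) * X ^ j) * (?F x / rcis r x ^ (n + j))))"
    by simp
  also have "\<dots> = (\<Sum>j\<le>d. of_real (real (d choose j) * X ^ j) * (LBINT x:{-pi..pi}. ?F x / rcis r x ^ (n + j)))"
  proof -
    have int: "integrable lborel (\<lambda>x. indicator {-pi..pi} x *\<^sub>R (?F x / rcis r x ^ (n + j)))" for j
      using continuous_on_partition_gf_rcis[OF r] ne unfolding rcis_def
      by (intro borel_integrable_atLeastAtMost'[unfolded set_integrable_def] continuous_intros) auto
    show ?thesis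
      unfolding set_lebesgue_integral_def scaleR_sum_right mult_scaleR_right[symmetric]
      by (subst Bochner_Integration.integral_sum) (auto intro!: integrable_mult_right int simp del: mult_scaleR_right)
  qed
  also have "\<dots> = (\<Sum>j\<le>d. of_real (real (d choose j) * X ^ j) * of_real (2 * pi * partition_count (n + j)))"
    by (intro sum.cong refl) (use coeff in auto)
  also have "\<dots> = of_real (2 * pi * poly (jensen_poly d n) X)"
    by (simp add: jensen_poly_def poly_sum poly_monom sum_distrib_left atMost_atLeast0 mult_ac)
  finally show ?thesis .
qed

section \<open>Hermite polynomials\<close>

text \<open>Serves twice, for the interlacing zeros of the Hermite polynomials and for the final
  count. The zeros lie in consecutive disjoint intervals, which makes them distinct.\<close>

lemma alternating_poly_roots:
  fixes p :: "real poly" and a :: "nat \<Rightarrow> real"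
  assumes a: "\<And>i. i < m \<Longrightarrow> a i < a (Suc i)"
    and p: "\<And>i. i < m \<Longrightarrow> poly p (a i) * poly p (a (Suc i)) < 0"
  shows "\<exists>y. (\<forall>i<m. a i < y i \<and> y i < a (Suc i) \<and> poly p (y i) = 0) \<and> (\<forall>i j. i < j \<longrightarrow> j < m \<longrightarrow> y i < y j)"
proof -
  have "\<exists>y. a i < y \<and> y < a (Suc i) \<and> poly p y = 0" if "i < m" for i
    using poly_IVT[OF a[OF that] p[OF that]] by blast
  then obtain y where y: "\<And>i. i < m \<Longrightarrow> a i < y i \<and> y i < a (Suc i) \<and> poly p (y i) = 0"
    by metis
  have mono: "a (Suc i) \<le> a j" if "i < j" "j < m" for i j
    using that by (induction j) (force simp: less_Suc_eq dest: a[OF Suc_lessD] intro: order_trans less_imp_le)+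
  have "y i < y j" if "i < j" "j < m" for i j
    using y[of i] y[of j] mono[OF that] that by linarith
  with y show ?thesis
    by blast
qed

text \<open>The difference from the product loses its coefficient at m, so its degree drops below m
  although it has m zeros.\<close>

lemma monic_poly_eq_prod:
  fixes p :: "'a::idom poly"
  assumes deg: "degree p \<le> m" and lead: "coeff p m = 1"
    and roots: "\<And>i. i < m \<Longrightarrow> poly p (y i) = 0" and inj: "inj_on y {..<m}"
  shows "p = (\<Prod>i<m. [:- y i, 1:])"
proof (rule ccontr)
  let ?q = "\<Prod>i<m. [:- y i, 1:]"
  define r where "r = p - ?q"
  assume "p \<noteq> ?q"
  then have "r \<noteq> 0"
    by (simp add: r_def)
  have degq: "degree ?q = m"
    by (subst degree_prod_eq_sum_degree) auto
  have "lead_coeff ?q = 1"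
    by (simp add: lead_coeff_prod)
  then have "coeff r m = 0"
    by (simp add: r_def lead degq)
  moreover have "degree r \<le> m"
    using deg degq by (simp add: r_def degree_diff_le)
  ultimately have less: "degree r < m \<or> m = 0"
    by (metis \<open>r \<noteq> 0\<close> le_neq_implies_less leading_coeff_0_iff)
  have "y ` {..<m} \<subseteq> {x. poly r x = 0}"
    using roots by (auto simp: r_def poly_prod)
  then have "m \<le> card {x. poly r x = 0}"
    using card_mono[OF poly_roots_finite[OF \<open>r \<noteq> 0\<close>]] inj by (metis card_image card_lessThan)
  also have "\<dots> \<le> degree r"
    by (rule card_poly_roots_bound[OF \<open>r \<noteq> 0\<close>])
  \<comment> \<open>Only m = 0 escapes the degree count; there the vanishing coefficient is the
    whole polynomial.\<close>
  finally have "m = 0"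
    using less by simp
  with \<open>coeff r m = 0\<close> \<open>degree r \<le> m\<close> \<open>r \<noteq> 0\<close> show False
    by (metis le_zero_eq leading_coeff_0_iff)
qed

text \<open>The probabilists' polynomials He_n, generated by the raising operator x - d/dx. In this
  form He_(n+1) = - He_n' at each zero of He_n, which drives the interlacing argument.\<close>

primrec hermite :: "nat \<Rightarrow> real poly" where
  "hermite 0 = 1"
| "hermite (Suc n) = pCons 0 (hermite n) - pderiv (hermite n)"

text \<open>The Appell property. It trades derivatives for lower Hermite polynomials: this gives the
  three-term recurrence, and it identifies (d + 1) He_d with the derivative of He_(d+1).\<close>

lemma pderiv_hermite: "pderiv (hermite (Suc n)) = smult (real (Suc n)) (hermite n)"
proof (induction n)
  case 0
  show ?case
    by (simp add: pderiv_pCons)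
next
  case (Suc n)
  have "pderiv (hermite (Suc (Suc n))) =
      hermite (Suc n) + pCons 0 (pderiv (hermite (Suc n))) - pderiv (pderiv (hermite (Suc n)))"
    by (subst hermite.simps(2)) (simp only: pderiv_diff pderiv_pCons)
  also have "\<dots> = hermite (Suc n) + smult (real (Suc n)) (pCons 0 (hermite n) - pderiv (hermite n))"
    unfolding Suc.IH by (simp add: pderiv_smult smult_diff_right)
  also have "\<dots> = smult (real (Suc (Suc n))) (hermite (Suc n))"
    by (simp only: hermite.simps(2)[symmetric] of_nat_Suc[of "Suc n"] smult_add_left) simp
  finally show ?case .
qed

lemma poly_hermite_Suc_Suc:
  "poly (hermite (Suc (Suc n))) x = x * poly (hermite (Suc n)) x - real (Suc n) * poly (hermite n) x"
  using pderiv_hermite[of n] by (simp del: hermite.simps add: hermite.simps(2)[of "Suc n"])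

lemma monic_hermite: "degree (hermite n) \<le> n \<and> coeff (hermite n) n = 1"
proof (induction n)
  case (Suc n)
  have "degree (hermite (Suc n)) \<le> Suc n"
    using Suc by (auto intro!: degree_diff_le simp: degree_pderiv)
  moreover have "coeff (hermite n) (Suc (Suc n)) = 0"
    using Suc by (intro coeff_eq_0) auto
  ultimately show ?case
    using Suc by (simp add: coeff_pderiv)
qed simp

lemma poly_hermite_minus: "poly (hermite n) (- x) = (- 1) ^ n * poly (hermite n) x"
  by (induction n rule: induct_nat_012)
     (auto simp: poly_hermite_Suc_Suc algebra_simps simp del: hermite.simps(2) simp: hermite.simps(2)[of 0])

text \<open>If x >= k + 2 and 0 < He_k <= He_(k+1) at x, the recurrence gives He_(k+2) >= (x - k -
  1) He_(k+1) >= He_(k+1), so growth propagates. Together with parity this confines all zeros of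
  He_n to (-n, n).\<close>

lemma poly_hermite_pos:
  assumes "real n \<le> x"
  shows "0 < poly (hermite n) x"
proof -
  have *: "0 < poly (hermite k) x \<and> poly (hermite k) x \<le> poly (hermite (Suc k)) x" if "real (Suc k) \<le> x" for k
    using that
  proof (induction k)
    case (Suc k)
    then have IH: "0 < poly (hermite k) x" "poly (hermite k) x \<le> poly (hermite (Suc k)) x"
      by auto
    have "poly (hermite (Suc k)) x \<le> (x - real (Suc k)) * poly (hermite (Suc k)) x"
      using mult_right_mono[of 1 "x - real (Suc k)" "poly (hermite (Suc k)) x"] Suc.prems IH by linarith
    also have "\<dots> = x * poly (hermite (Suc k)) x - real (Suc k) * poly (hermite (Suc k)) x"
      by (rule left_diff_distrib)
    also have "\<dots> \<le> poly (hermite (Suc (Suc k))) x"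
      unfolding poly_hermite_Suc_Suc using IH by (intro diff_left_mono mult_left_mono) auto
    finally show ?case
      using IH by linarith
  qed simp
  show ?thesis
  proof (cases n)
    case (Suc k)
    with assms *[of k] show ?thesis
      by (auto simp del: hermite.simps)
  qed simp
qed

text \<open>The n - 1 - i factors with j > i are negative, the others positive.\<close>

lemma prod_diff_sign:
  fixes x :: "nat \<Rightarrow> real"
  assumes "\<And>i j. i < j \<Longrightarrow> j < n \<Longrightarrow> x i < x j" and "i < n"
  shows "0 < (- 1) ^ (n - Suc i) * (\<Prod>j\<in>{..<n} - {i}. x i - x j)"
proof -
  have "{..<n} - {i} = {..<i} \<union> {Suc i..<n}"
    using assms(2) by auto
  then have "(\<Prod>j\<in>{..<n} - {i}. x i - x j) = (\<Prod>j<i. x i - x j) * (\<Prod>j\<in>{Suc i..<n}. x i - x j)"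
    by (simp add: prod.union_disjoint disjoint_iff)
  also have "(\<Prod>j\<in>{Suc i..<n}. x i - x j) = (\<Prod>j\<in>{Suc i..<n}. - 1 * (x j - x i))"
    by simp
  also have "\<dots> = (- 1) ^ (n - Suc i) * (\<Prod>j\<in>{Suc i..<n}. x j - x i)"
    by (subst prod.distrib) simp
  finally have "(- 1) ^ (n - Suc i) * (\<Prod>j\<in>{..<n} - {i}. x i - x j) =
     ((- 1) ^ (n - Suc i) * (- 1) ^ (n - Suc i)) * ((\<Prod>j<i. x i - x j) * (\<Prod>j\<in>{Suc i..<n}. x j - x i))"
    by (simp only: mult_ac)
  also have "(- 1) ^ (n - Suc i) * (- 1) ^ (n - Suc i) = (1::real)"
    by (simp flip: power_mult_distrib)
  finally show ?thesis
    using assms by (auto intro!: mult_pos_pos prod_pos)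
qed

lemma poly_pderiv_prod_root:
  fixes x :: "nat \<Rightarrow> real"
  assumes "i < n"
  shows "poly (pderiv (\<Prod>j<n. [:- x j, 1:])) (x i) = (\<Prod>j\<in>{..<n} - {i}. x i - x j)"
proof -
  have "poly (pderiv (\<Prod>j<n. [:- x j, 1:])) (x i) = (\<Sum>k<n. \<Prod>j\<in>{..<n} - {k}. x i - x j)"
    by (simp add: pderiv_prod pderiv_pCons poly_sum poly_prod)
  also have "\<dots> = (\<Sum>k\<in>{i}. \<Prod>j\<in>{..<n} - {k}. x i - x j)"
    using assms by (intro sum.mono_neutral_right) (auto intro!: prod_zero)
  finally show ?thesis
    by simp
qed

text \<open>Induction by interlacing: at the ordered simple zeros of He_n the values He_(n+1) = -
  He_n' alternate, and the points n + 1 and -(n + 1) lie beyond all of them with the two missing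
  signs. This makes n + 1 sign changes.\<close>

lemma hermite_eq_prod:
  "\<exists>x. (\<forall>i j. i < j \<longrightarrow> j < n \<longrightarrow> x i < x j) \<and> hermite n = (\<Prod>i<n. [:- x i, 1:])"
proof (induction n)
  case (Suc n)
  then obtain x where x: "\<And>i j. i < j \<Longrightarrow> j < n \<Longrightarrow> x i < x j" and eq: "hermite n = (\<Prod>i<n. [:- x i, 1:])"
    by blast
  have root: "poly (hermite n) (x i) = 0" if "i < n" for i
    unfolding eq poly_prod using that by (intro prod_zero) auto
  have bound: "\<bar>x i\<bar> < real (Suc n)" if "i < n" for i
    using root[OF that] poly_hermite_pos[of n "x i"] poly_hermite_pos[of n "- x i"]
    by (cases "real n \<le> \<bar>x i\<bar>") (auto simp: poly_hermite_minus abs_if split: if_splits)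
  \<comment> \<open>The zeros of He_n framed by the two outer points; hence the shift from i to i -
    1.\<close>
  define a where "a i = (if i = 0 then - real (Suc n) else if i = Suc n then real (Suc n) else x (i - 1))" for i
  have sign: "0 < (- 1) ^ (Suc n - i) * poly (hermite (Suc n)) (a i)" if i: "i \<le> Suc n" for i
  proof -
    consider "i = 0" | "i = Suc n" | "0 < i" "i \<le> n"
      using i by linarith
    then show ?thesis
    proof cases
      case 1
      then show ?thesis
        using poly_hermite_pos[of "Suc n" "real (Suc n)"] poly_hermite_minus[of "Suc n" "real (Suc n)"]
        by (simp add: a_def mult.assoc[symmetric] del: hermite.simps power_Suc of_nat_Suc flip: power_mult_distrib)
    next
      case 2
      then show ?thesis
        using poly_hermite_pos[of "Suc n" "real (Suc n)"] by (simp add: a_def del: hermite.simps)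
    next
      case 3
      then obtain k where k: "i = Suc k" "k < n"
        by (cases i) auto
      then have "poly (hermite (Suc n)) (a i) = - poly (pderiv (hermite n)) (x k)"
        using root[of k] by (simp add: a_def)
      also have "\<dots> = - (\<Prod>j\<in>{..<n} - {k}. x k - x j)"
        unfolding eq using k by (simp add: poly_pderiv_prod_root)
      finally have "(- 1) ^ (Suc n - i) * poly (hermite (Suc n)) (a i) =
          (- 1) ^ (n - Suc k) * (\<Prod>j\<in>{..<n} - {k}. x k - x j)"
        using k by (simp add: Suc_diff_Suc[symmetric] del: hermite.simps)
      then show ?thesis
        using prod_diff_sign[where x = x and n = n and i = k, OF x] k by (simp del: hermite.simps)
    qed
  qed
  have "\<exists>y. (\<forall>i<Suc n. a i < y i \<and> y i < a (Suc i) \<and> poly (hermite (Suc n)) (y i) = 0) \<and>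
     (\<forall>i j. i < j \<longrightarrow> j < Suc n \<longrightarrow> y i < y j)"
  proof (rule alternating_poly_roots)
    fix i assume i: "i < Suc n"
    show "a i < a (Suc i)"
      using i bound[of 0] bound[of "n - 1"] x[of "i - 1" i] by (auto simp: a_def)
    have "0 < ((- 1) ^ (Suc n - i) * poly (hermite (Suc n)) (a i)) *
       ((- 1) ^ (Suc n - Suc i) * poly (hermite (Suc n)) (a (Suc i)))"
      using i by (intro mult_pos_pos sign) auto
    also have "(- 1) ^ (Suc n - i) = - ((- 1) ^ (Suc n - Suc i) :: real)"
      using i by (simp add: Suc_diff_le)
    finally show "poly (hermite (Suc n)) (a i) * poly (hermite (Suc n)) (a (Suc i)) < 0"
      by (cases "even (n - i)") (simp_all del: hermite.simps)
  qed
  then obtain y where y: "\<And>i. i < Suc n \<Longrightarrow> poly (hermite (Suc n)) (y i) = 0"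
      and mono: "\<And>i j. i < j \<Longrightarrow> j < Suc n \<Longrightarrow> y i < y j"
    by blast
  have "inj_on y {..<Suc n}"
    by (rule linorder_inj_onI) (use mono in \<open>force+\<close>)
  then have "hermite (Suc n) = (\<Prod>i<Suc n. [:- y i, 1:])"
    using monic_hermite y by (intro monic_poly_eq_prod) blast+
  with mono show ?case
    by blast
qed simp

text \<open>By the recurrence, the right-hand side is \<open>H_(n+1)' H_n - H_n' H_(n+1)\<close>, the Christoffel--Darboux
  kernel on the diagonal up to the factor \<open>n!\<close>; at a zero of \<open>H_(n+1)\<close> it reduces to \<open>(n + 1) H_n^2\<close>.\<close>

lemma hermite_Christoffel:
  fixes x :: real
  shows "fact n \<le> real (Suc n) * (poly (hermite n) x)\<^sup>2 - x * poly (hermite n) x * poly (hermite (Suc n)) x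
     + (poly (hermite (Suc n)) x)\<^sup>2"
proof (induction n)
  case (Suc n)
  let ?h = "\<lambda>k. poly (hermite k) x"
  let ?W = "\<lambda>n. real (Suc n) * (?h n)\<^sup>2 - x * ?h n * ?h (Suc n) + (?h (Suc n))\<^sup>2"
  have "?W (Suc n) = real (Suc n) * ?W n + (?h (Suc n))\<^sup>2"
    unfolding poly_hermite_Suc_Suc by (simp add: power2_eq_square algebra_simps del: hermite.simps)
  moreover have "fact (Suc n) \<le> real (Suc n) * ?W n"
    unfolding fact_Suc by (intro mult_left_mono Suc.IH) auto
  ultimately show ?case
    using zero_le_power2[of "?h (Suc n)"] by linarith
qed (simp add: power2_eq_square)

text \<open>The constant 4, although 2 would come out of the proof, lets (d + 1) He_d^2 >= d! yield
  He_d^2 >= 1/4, whose square root is rational.\<close>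

lemma fact_ge_quarter: "real (Suc d) / 4 \<le> fact d"
proof -
  have "Suc d \<le> 2 ^ d"
    by (induction d) auto
  moreover have "2 ^ d \<le> 2 * (fact d :: nat)"
  proof (induction d)
    case (Suc d)
    show ?case
    proof (cases d)
      case (Suc e)
      have "2 ^ Suc d \<le> 2 * (2 * (fact d :: nat))"
        using Suc.IH by simp
      also have "\<dots> \<le> 2 * (Suc d * fact d)"
        using Suc by (intro mult_left_mono mult_right_mono) auto
      finally show ?thesis
        by simp
    qed simp
  qed simp
  ultimately have "Suc d \<le> 4 * fact d"
    by linarith
  then have "real (Suc d) \<le> real (4 * fact d)"
    by (simp only: of_nat_le_iff)
  then show ?thesis
    by simp
qed

text \<open>At the zeros of He_(d+1) the signs come from (d + 1) He_d = He_(d+1)', the zeros being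
  simple and ordered; the size comes from \<open>hermite_Christoffel\<close>. The bound on the
  points makes the later estimates uniform in s.\<close>

lemma hermite_alternation:
  "\<exists>x. (\<forall>i j. i < j \<longrightarrow> j \<le> d \<longrightarrow> x i < x j) \<and>
     (\<forall>i\<le>d. \<bar>x i\<bar> \<le> real (Suc d) \<and> 1 / 2 \<le> (- 1) ^ (d - i) * poly (hermite d) (x i))"
proof -
  obtain x where x: "\<And>i j. i < j \<Longrightarrow> j < Suc d \<Longrightarrow> x i < x j" and eq: "hermite (Suc d) = (\<Prod>i<Suc d. [:- x i, 1:])"
    using hermite_eq_prod[of "Suc d"] by blast
  have "\<bar>x i\<bar> \<le> real (Suc d) \<and> 1 / 2 \<le> (- 1) ^ (d - i) * poly (hermite d) (x i)" if i: "i \<le> d" for i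
  proof
    let ?h = "poly (hermite d) (x i)"
    have root: "poly (hermite (Suc d)) (x i) = 0"
      unfolding eq poly_prod using i by (intro prod_zero) auto
    then show "\<bar>x i\<bar> \<le> real (Suc d)"
      using poly_hermite_pos[of "Suc d" "x i"] poly_hermite_pos[of "Suc d" "- x i"]
      by (cases "real (Suc d) \<le> \<bar>x i\<bar>")
         (auto simp: poly_hermite_minus abs_if simp del: hermite.simps split: if_splits)
    have eq': "real (Suc d) * ?h = (\<Prod>j\<in>{..<Suc d} - {i}. x i - x j)"
      using poly_pderiv_prod_root[where x = x and n = "Suc d" and i = i] i unfolding eq[symmetric] pderiv_hermite by simp
    have "0 < (- 1) ^ (d - i) * (real (Suc d) * ?h)"
      using prod_diff_sign[where x = x and n = "Suc d" and i = i, OF x] i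
      unfolding eq' by (simp only: diff_Suc_Suc less_Suc_eq_le)
    then have "0 < real (Suc d) * ((- 1) ^ (d - i) * ?h)"
      by (simp only: mult.left_commute)
    then have pos: "0 < (- 1) ^ (d - i) * ?h"
      by (rule zero_less_mult_pos) simp
    have "real (Suc d) / 4 \<le> real (Suc d) * ?h\<^sup>2"
    proof -
      have "fact d \<le> real (Suc d) * ?h\<^sup>2"
        using hermite_Christoffel[of d "x i"] root by (simp del: hermite.simps of_nat_Suc)
      then show ?thesis
        using fact_ge_quarter[of d] by linarith
    qed
    then have "real (Suc d) * (1 / 4) \<le> real (Suc d) * ?h\<^sup>2"
      by simp
    then have "1 / 4 \<le> ?h\<^sup>2"
      by (rule mult_left_le_imp_le) simp
    then have "(1 / 2)\<^sup>2 \<le> ((- 1) ^ (d - i) * ?h)\<^sup>2"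
      by (simp add: power_mult_distrib power_divide flip: power_mult)
    then show "1 / 2 \<le> (- 1) ^ (d - i) * ?h"
      by (rule power2_le_imp_le) (use pos in simp)
  qed
  with x show ?thesis
    by (metis less_Suc_eq_le)
qed

section \<open>Comparison with a Gaussian integral\<close>

text \<open>The m-th power of u/m <= exp (u/m) gives u^m <= m^m exp u. With u = 1 + |y| <= 2 +
  y^2/4, half of the Gaussian exponent pays for the polynomial.\<close>

lemma one_plus_abs_power_gauss_le:
  fixes y :: real
  shows "(1 + \<bar>y\<bar>) ^ m * exp (- y\<^sup>2 / 2) \<le> real m ^ m * exp 2 * exp (- y\<^sup>2 / 4)"
proof -
  have "(1 + \<bar>y\<bar>) ^ m \<le> real m ^ m * exp (1 + \<bar>y\<bar>)"
  proof (cases "m = 0")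
    case False
    have "(1 + \<bar>y\<bar>) / real m \<le> exp ((1 + \<bar>y\<bar>) / real m)"
      using exp_ge_add_one_self[of "(1 + \<bar>y\<bar>) / real m"] by linarith
    then have "((1 + \<bar>y\<bar>) / real m) ^ m \<le> exp ((1 + \<bar>y\<bar>) / real m) ^ m"
      by (intro power_mono) auto
    also have "\<dots> = exp (1 + \<bar>y\<bar>)"
      using False by (simp flip: exp_of_nat_mult)
    finally show ?thesis
      using False by (simp add: power_divide field_simps)
  qed simp
  moreover have "1 + \<bar>y\<bar> \<le> 2 + y\<^sup>2 / 4"
    using zero_le_power2[of "\<bar>y\<bar> / 2 - 1"] by (simp add: power2_eq_square algebra_simps)
  ultimately have "(1 + \<bar>y\<bar>) ^ m \<le> real m ^ m * exp (2 + y\<^sup>2 / 4)"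
    by (elim order_trans) (intro mult_left_mono, auto)
  then have "(1 + \<bar>y\<bar>) ^ m * exp (- y\<^sup>2 / 2) \<le> real m ^ m * exp (2 + y\<^sup>2 / 4) * exp (- y\<^sup>2 / 2)"
    by (intro mult_right_mono) auto
  also have "\<dots> = real m ^ m * (exp (2 + y\<^sup>2 / 4) * exp (- y\<^sup>2 / 2))"
    by simp
  also have "exp (2 + y\<^sup>2 / 4) * exp (- y\<^sup>2 / 2) = exp 2 * exp (- y\<^sup>2 / 4)"
    by (simp flip: exp_add)
  finally show ?thesis
    by simp
qed

lemma has_bochner_integral_exp_quarter:
  "has_bochner_integral lborel (\<lambda>y::real. exp (- y\<^sup>2 / 4)) (2 * sqrt pi)"
proof -
  have "has_bochner_integral lborel (\<lambda>y. 2 * sqrt pi * normal_density 0 (sqrt 2) y) (2 * sqrt pi * 1)"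
    using integrable_normal_density[of "sqrt 2" 0] integral_normal_density[of "sqrt 2" 0]
    by (intro has_bochner_integral_mult_right) (auto simp: has_bochner_integral_iff)
  moreover have "sqrt (4 * pi) = 2 * sqrt pi"
    by (simp add: real_sqrt_mult)
  ultimately show ?thesis
    by (simp add: normal_density_def)
qed

lemma norm_add_ii_le:
  fixes s y :: real
  shows "norm (of_real s + \<i> * of_real y) \<le> (1 + \<bar>s\<bar>) * (1 + \<bar>y\<bar>)"
proof -
  have "norm (of_real s + \<i> * of_real y) \<le> \<bar>s\<bar> + \<bar>y\<bar>"
    by (rule norm_triangle_le) (simp add: norm_mult)
  also have "\<dots> \<le> (1 + \<bar>s\<bar>) * (1 + \<bar>y\<bar>)"
    by (simp add: algebra_simps)
  finally show ?thesis .
qed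

text \<open>Integrand of the classical formula sqrt (2 pi) He_m(s) = integral of exp (-y^2/2) (s + i
  y)^m over the real line.\<close>

definition gauss_power :: "real \<Rightarrow> nat \<Rightarrow> real \<Rightarrow> complex" where
  "gauss_power s m y = of_real (exp (- y\<^sup>2 / 2)) * (of_real s + \<i> * of_real y) ^ m"

lemma norm_gauss_power_le:
  "norm (gauss_power s m y) \<le> (1 + \<bar>s\<bar>) ^ m * (real m ^ m * exp 2 * exp (- y\<^sup>2 / 4))"
proof -
  have "norm (gauss_power s m y) \<le> exp (- y\<^sup>2 / 2) * ((1 + \<bar>s\<bar>) * (1 + \<bar>y\<bar>)) ^ m"
    unfolding gauss_power_def norm_mult norm_power
    using norm_add_ii_le by (intro mult_mono power_mono) auto
  also have "\<dots> = (1 + \<bar>s\<bar>) ^ m * ((1 + \<bar>y\<bar>) ^ m * exp (- y\<^sup>2 / 2))"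
    by (simp add: power_mult_distrib)
  also have "\<dots> \<le> (1 + \<bar>s\<bar>) ^ m * (real m ^ m * exp 2 * exp (- y\<^sup>2 / 4))"
    by (intro mult_left_mono one_plus_abs_power_gauss_le) auto
  finally show ?thesis .
qed

lemma continuous_on_gauss_power: "continuous_on S (gauss_power s m)"
  unfolding gauss_power_def by (intro continuous_intros) auto

lemma integrable_gauss_power: "integrable lborel (gauss_power s m)"
proof (rule Bochner_Integration.integrable_bound)
  show "integrable lborel (\<lambda>y. (1 + \<bar>s\<bar>) ^ m * (real m ^ m * exp 2 * exp (- y\<^sup>2 / 4)))"
    using has_bochner_integral_exp_quarter by (intro integrable_mult_right) (simp add: has_bochner_integral_iff)
  show "gauss_power s m \<in> borel_measurable lborel"
    using borel_measurable_continuous_onI[OF continuous_on_gauss_power] by simp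
  show "AE y in lborel. norm (gauss_power s m y) \<le> norm ((1 + \<bar>s\<bar>) ^ m * (real m ^ m * exp 2 * exp (- y\<^sup>2 / 4)))"
    using norm_gauss_power_le by (intro always_eventually allI) (metis abs_ge_self order_trans real_norm_def)
qed

lemma tendsto_gauss_power:
  assumes "F = at_top \<or> F = at_bot"
  shows "(gauss_power s m \<longlongrightarrow> 0) F"
proof (rule Lim_null_comparison)
  show "\<forall>\<^sub>F y in F. norm (gauss_power s m y) \<le> (1 + \<bar>s\<bar>) ^ m * (real m ^ m * exp 2 * exp (- y\<^sup>2 / 4))"
    using norm_gauss_power_le by (intro always_eventually allI)
  have "filterlim (\<lambda>y::real. y\<^sup>2 / 4) at_top at_top" "filterlim (\<lambda>y::real. y\<^sup>2 / 4) at_top at_bot"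
    by real_asymp+
  then have "filterlim (\<lambda>y::real. - y\<^sup>2 / 4) at_bot F"
    using assms by (auto simp: filterlim_uminus_at_top)
  from filterlim_compose[OF exp_at_bot this]
  have "((\<lambda>y. (1 + \<bar>s\<bar>) ^ m * (real m ^ m * exp 2 * exp (- y\<^sup>2 / 4))) \<longlongrightarrow> (1 + \<bar>s\<bar>) ^ m * (real m ^ m * exp 2 * 0)) F"
    by (intro tendsto_intros)
  then show "((\<lambda>y. (1 + \<bar>s\<bar>) ^ m * (real m ^ m * exp 2 * exp (- y\<^sup>2 / 4))) \<longlongrightarrow> 0) F"
    by simp
qed

lemma gauss_power_Suc: "gauss_power s (Suc m) y = (of_real s + \<i> * of_real y) * gauss_power s m y"
  by (simp add: gauss_power_def)

text \<open>The derivative of \<open>gauss_power s m\<close> integrates to 0; writing its factor -y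
  as i (s + i y) - i s produces the three-term Hermite recurrence. At m = 0 the truncated index
  \<open>m - 1\<close> is 0 and comes with the factor 0.\<close>

lemma integral_gauss_power_recurrence:
  "integral\<^sup>L lborel (gauss_power s (Suc m)) =
     of_real s * integral\<^sup>L lborel (gauss_power s m) - of_nat m * integral\<^sup>L lborel (gauss_power s (m - 1))"
proof -
  define f where "f y = \<i> * (gauss_power s (Suc m) y - of_real s * gauss_power s m y + of_nat m * gauss_power s (m - 1) y)" for y
  have int: "integrable lborel f"
    unfolding f_def by (intro integrable_mult_right Bochner_Integration.integrable_add Bochner_Integration.integrable_diff integrable_gauss_power)
  have deriv: "(gauss_power s m has_vector_derivative f y) (at y)" for y
  proof -
    have "((\<lambda>z. exp (- z\<^sup>2 / 2) * (of_real s + \<i> * z) ^ m) has_field_derivative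
        - z * exp (- z\<^sup>2 / 2) * (of_real s + \<i> * z) ^ m +
        exp (- z\<^sup>2 / 2) * (of_nat m * (of_real s + \<i> * z) ^ (m - 1) * \<i>)) (at z)" for z :: complex
      by (auto intro!: derivative_eq_intros)
    from has_vector_derivative_real_field[OF this[of "of_real y"]]
    have "(gauss_power s m has_vector_derivative (- of_real y * gauss_power s m y + \<i> * of_nat m * gauss_power s (m - 1) y)) (at y)"
      unfolding gauss_power_def[abs_def] exp_of_real[symmetric] by (simp add: mult_ac)
    moreover have "- of_real y * gauss_power s m y + \<i> * of_nat m * gauss_power s (m - 1) y = f y"
      by (simp add: f_def gauss_power_Suc algebra_simps)
    ultimately show ?thesis
      by simp
  qed
  have "(LBINT y=-\<infinity>..\<infinity>. f y) = 0 - 0"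
  proof (rule interval_integral_FTC_integrable)
    show "isCont f y" for y
      using continuous_on_gauss_power[of UNIV] unfolding f_def
      by (intro continuous_intros) (simp_all add: continuous_on_eq_continuous_at)
    show "set_integrable lborel (einterval (-\<infinity>) \<infinity>) f"
      using int by (simp add: set_integrable_def einterval_def)
    show "((gauss_power s m \<circ> real_of_ereal) \<longlongrightarrow> 0) (at_right (-\<infinity>))"
      "((gauss_power s m \<circ> real_of_ereal) \<longlongrightarrow> 0) (at_left \<infinity>)"
      by (simp_all add: ereal_tendsto_simps tendsto_gauss_power)
  qed (use deriv in auto)
  then have "integral\<^sup>L lborel f = 0"
    by (simp add: interval_lebesgue_integral_def einterval_def set_lebesgue_integral_def)
  then have "integral\<^sup>L lborel (gauss_power s (Suc m)) - of_real s * integral\<^sup>L lborel (gauss_power s m)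
      + of_nat m * integral\<^sup>L lborel (gauss_power s (m - 1)) = 0"
    unfolding f_def by (simp add: integrable_gauss_power)
  then show ?thesis
    by (simp add: algebra_simps add_eq_0_iff2)
qed

lemma integral_gauss_power_0: "integral\<^sup>L lborel (gauss_power s 0) = of_real (sqrt (2 * pi))"
proof -
  have "gauss_power s 0 = (\<lambda>y. of_real (sqrt (2 * pi) * std_normal_density y))"
    by (simp add: gauss_power_def fun_eq_iff std_normal_density_def)
  then have "integral\<^sup>L lborel (gauss_power s 0) = of_real (\<integral>y. sqrt (2 * pi) * std_normal_density y \<partial>lborel)"
    by (simp only: integral_complex_of_real)
  then show ?thesis
    by simp
qed

lemma integral_gauss_power:
  "integral\<^sup>L lborel (gauss_power s d) = of_real (sqrt (2 * pi) * poly (hermite d) s)"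
proof (induction d rule: induct_nat_012)
  case 1
  show ?case
    using integral_gauss_power_recurrence[of s 0] by (simp add: integral_gauss_power_0)
next
  case (ge2 d)
  then show ?case
    by (subst integral_gauss_power_recurrence) (simp add: poly_hermite_Suc_Suc algebra_simps del: hermite.simps)
qed (simp add: integral_gauss_power_0)

text \<open>Telescoping. With 1 <= K the bound K^d replaces K^(d-1), which avoids a truncated
  exponent.\<close>

lemma norm_power_diff_le:
  fixes a b :: "'a::{real_normed_div_algebra, comm_ring_1}"
  assumes "norm a \<le> K" "norm b \<le> K" "1 \<le> K"
  shows "norm (a ^ d - b ^ d) \<le> real d * norm (a - b) * K ^ d"
proof (induction d)
  case (Suc d)
  have "a ^ Suc d - b ^ Suc d = a * (a ^ d - b ^ d) + (a - b) * b ^ d"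
    by (simp add: algebra_simps)
  then have "norm (a ^ Suc d - b ^ Suc d) \<le> norm a * norm (a ^ d - b ^ d) + norm (a - b) * norm b ^ d"
    by (metis norm_mult norm_power norm_triangle_ineq)
  also have "\<dots> \<le> K * (real d * norm (a - b) * K ^ d) + norm (a - b) * K ^ Suc d"
  proof (intro add_mono mult_mono Suc.IH assms(1) order_refl)
    have "norm b ^ d \<le> K ^ d"
      using assms by (intro power_mono) auto
    also have "\<dots> \<le> K ^ Suc d"
      using assms by (intro power_increasing) auto
    finally show "norm b ^ d \<le> K ^ Suc d" .
  qed (use assms in auto)
  also have "\<dots> = real (Suc d) * norm (a - b) * K ^ Suc d"
    by (simp add: algebra_simps)
  finally show ?case .
qed simp

text \<open>\<open>E\<close> will be the normalised generating function on the circle, and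
  \<open>v y\<close> is the exact quantity that i y approximates. The three small terms are the
  cubic error of the exponent, the curvature of the circle and the Gaussian tail beyond T. All are
  absorbed in powers of (1 + |s|) (1 + |y|), hence the exponent d + 3; the last summand is the
  trivial bound on T <= |y| <= A.\<close>

lemma gauss_comparison:
  fixes E v :: "real \<Rightarrow> complex" and s A T :: real
  assumes cont: "continuous_on {-A..A} E" "continuous_on {-A..A} v"
    and T: "0 < T" "T \<le> A" and nonneg: "0 \<le> \<epsilon>" "0 \<le> \<delta>" "0 \<le> \<eta>"
    and major: "\<And>y. \<bar>y\<bar> \<le> T \<Longrightarrow> norm (E y - of_real (exp (- y\<^sup>2 / 2))) \<le> \<epsilon> * \<bar>y\<bar> ^ 3 * exp (- y\<^sup>2 / 2)"
    and minor: "\<And>y. T \<le> \<bar>y\<bar> \<Longrightarrow> \<bar>y\<bar> \<le> A \<Longrightarrow> norm (E y) \<le> \<eta>"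
    and v: "\<And>y. \<bar>y\<bar> \<le> A \<Longrightarrow> norm (v y) \<le> \<bar>y\<bar>" "\<And>y. \<bar>y\<bar> \<le> A \<Longrightarrow> norm (v y - \<i> * of_real y) \<le> \<delta> * y\<^sup>2"
  shows "norm ((LBINT y:{-A..A}. E y * (of_real s + v y) ^ d) - of_real (sqrt (2 * pi) * poly (hermite d) s))
    \<le> (\<epsilon> + real d * \<delta> + 1 / T ^ 3) * ((1 + \<bar>s\<bar>) ^ (d + 3) * (real (d + 3) ^ (d + 3) * exp 2)) * (2 * sqrt pi)
      + 2 * A * (\<eta> * (\<bar>s\<bar> + A) ^ d)"
proof -
  define f where "f y = indicator {-A..A} y *\<^sub>R (E y * (of_real s + v y) ^ d)" for y
  define c where "c = \<epsilon> + real d * \<delta> + 1 / T ^ 3"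
  define M where "M = (1 + \<bar>s\<bar>) ^ (d + 3) * (real (d + 3) ^ (d + 3) * exp 2)"
  define g where "g y = c * M * exp (- y\<^sup>2 / 4) + indicator {-A..A} y * (\<eta> * (\<bar>s\<bar> + A) ^ d)" for y :: real
  have c: "\<epsilon> + real d * \<delta> \<le> c" "1 / T ^ 3 \<le> c" "0 \<le> c"
    using T nonneg by (auto simp: c_def)
  have int_f: "integrable lborel f"
    unfolding f_def by (intro borel_integrable_atLeastAtMost'[unfolded set_integrable_def] continuous_intros cont)
  have bound: "norm (f y - gauss_power s d y) \<le> g y" for y
  proof -
    define e where "e = exp (- y\<^sup>2 / 2)"
    define P where "P = (1 + \<bar>s\<bar>) * (1 + \<bar>y\<bar>)"
    have e: "0 < e"
      by (simp add: e_def)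
    have P: "1 \<le> P" "\<bar>s\<bar> + \<bar>y\<bar> \<le> P" "\<bar>y\<bar> \<le> P"
      by (auto simp: P_def algebra_simps)
    have main: "c * (P ^ (d + 3) * e) \<le> c * M * exp (- y\<^sup>2 / 4)"
    proof -
      have "P ^ (d + 3) * e = (1 + \<bar>s\<bar>) ^ (d + 3) * ((1 + \<bar>y\<bar>) ^ (d + 3) * e)"
        by (simp only: P_def power_mult_distrib mult_ac)
      also have "\<dots> \<le> (1 + \<bar>s\<bar>) ^ (d + 3) * (real (d + 3) ^ (d + 3) * exp 2 * exp (- y\<^sup>2 / 4))"
        unfolding e_def by (intro mult_left_mono one_plus_abs_power_gauss_le) auto
      also have "\<dots> = M * exp (- y\<^sup>2 / 4)"
        by (simp only: M_def mult_ac)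
      finally show ?thesis
        using mult_left_mono[OF _ c(3)] by (simp only: mult.assoc)
    qed
    have sy: "norm (of_real s + \<i> * of_real y) \<le> P"
      unfolding P_def by (rule norm_add_ii_le)
    have y3: "\<bar>y\<bar> ^ 3 * P ^ d \<le> P ^ (d + 3)"
    proof -
      have "\<bar>y\<bar> ^ 3 * P ^ d \<le> P ^ 3 * P ^ d"
        using P by (intro mult_right_mono power_mono) auto
      then show ?thesis
        by (simp only: power_add mult.commute)
    qed
    show ?thesis
    proof (cases "\<bar>y\<bar> \<le> T")
      case True
      then have y: "\<bar>y\<bar> \<le> A" "y \<in> {-A..A}"
        using T by auto
      have sv: "norm (of_real s + v y) \<le> P"
        using norm_triangle_ineq[of "of_real s" "v y"] v(1)[OF y(1)] P(2) by simp
      \<comment> \<open>E z^d - e w^d = (E - e) z^d + e (z^d - w^d) separates the error of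
        \<open>E\<close> from that of \<open>v\<close>.\<close>
      have "norm (f y - gauss_power s d y) = norm ((E y - of_real e) * (of_real s + v y) ^ d
          + of_real e * ((of_real s + v y) ^ d - (of_real s + \<i> * of_real y) ^ d))"
        using y by (simp add: f_def gauss_power_def e_def algebra_simps)
      also have "\<dots> \<le> norm (E y - of_real e) * norm (of_real s + v y) ^ d
          + e * norm ((of_real s + v y) ^ d - (of_real s + \<i> * of_real y) ^ d)"
        using e by (intro order_trans[OF norm_triangle_ineq]) (simp add: norm_mult norm_power)
      also have "\<dots> \<le> (\<epsilon> * \<bar>y\<bar> ^ 3 * e) * P ^ d + e * (real d * (\<delta> * \<bar>y\<bar> ^ 2) * P ^ d)"
      proof (intro add_mono mult_mono power_mono sv)
        show "norm (E y - of_real e) \<le> \<epsilon> * \<bar>y\<bar> ^ 3 * e"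
          unfolding e_def by (rule major[OF True])
        have "norm ((of_real s + v y) ^ d - (of_real s + \<i> * of_real y) ^ d) \<le>
            real d * norm (v y - \<i> * of_real y) * P ^ d"
          using norm_power_diff_le[OF sv sy P(1), of d] by simp
        also have "\<dots> \<le> real d * (\<delta> * \<bar>y\<bar> ^ 2) * P ^ d"
          using v(2)[OF y(1)] P by (intro mult_right_mono mult_left_mono) auto
        finally show "norm ((of_real s + v y) ^ d - (of_real s + \<i> * of_real y) ^ d) \<le> real d * (\<delta> * \<bar>y\<bar> ^ 2) * P ^ d" .
      qed (use nonneg e P in auto)
      also have "\<dots> = e * (\<epsilon> * (\<bar>y\<bar> ^ 3 * P ^ d) + real d * \<delta> * (\<bar>y\<bar> ^ 2 * P ^ d))"
        by (simp add: algebra_simps)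
      also have "\<dots> \<le> e * (\<epsilon> * P ^ (d + 3) + real d * \<delta> * P ^ (d + 3))"
      proof (intro mult_left_mono add_mono y3)
        have "\<bar>y\<bar> ^ 2 * P ^ d \<le> P ^ 3 * P ^ d"
          using P power_mono[of "\<bar>y\<bar>" P 2] power_increasing[of 2 3 P] by (intro mult_right_mono) auto
        then show "\<bar>y\<bar> ^ 2 * P ^ d \<le> P ^ (d + 3)"
          by (simp only: power_add mult.commute)
      qed (use nonneg e in auto)
      also have "\<dots> = (\<epsilon> + real d * \<delta>) * (P ^ (d + 3) * e)"
        by (simp add: algebra_simps)
      also have "\<dots> \<le> c * (P ^ (d + 3) * e)"
        using c e P by (intro mult_right_mono) auto
      also have "\<dots> \<le> g y"
        using main nonneg T unfolding g_def by (intro order_trans[OF main]) auto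
      finally show ?thesis .
    next
      case False
      have "norm (gauss_power s d y) \<le> e * P ^ d"
        unfolding gauss_power_def norm_mult norm_power e_def[symmetric] using sy e P
        by (intro mult_mono power_mono) auto
      also have "\<dots> \<le> c * (P ^ (d + 3) * e)"
      proof -
        \<comment> \<open>Outside [-T, T] this factor turns the Gaussian tail into the same moment
          with weight 1 / T^3.\<close>
        have "1 \<le> (\<bar>y\<bar> / T) ^ 3"
          using False T by (intro one_le_power) simp
        then have "P ^ d \<le> (\<bar>y\<bar> / T) ^ 3 * P ^ d"
          using P mult_right_mono[of 1 "(\<bar>y\<bar> / T) ^ 3" "P ^ d"] by simp
        also have "\<dots> = 1 / T ^ 3 * (\<bar>y\<bar> ^ 3 * P ^ d)"
          by (simp add: power_divide)
        also have "\<dots> \<le> c * P ^ (d + 3)"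
          using c P y3 by (intro mult_mono) auto
        finally show ?thesis
          using e by simp
      qed
      also have "\<dots> \<le> c * M * exp (- y\<^sup>2 / 4)"
        by (rule main)
      finally have 1: "norm (gauss_power s d y) \<le> c * M * exp (- y\<^sup>2 / 4)" .
      have 2: "norm (f y) \<le> indicator {-A..A} y * (\<eta> * (\<bar>s\<bar> + A) ^ d)"
      proof (cases "y \<in> {-A..A}")
        case True
        then have y: "\<bar>y\<bar> \<le> A"
          by auto
        have "norm (E y) * norm (of_real s + v y) ^ d \<le> \<eta> * (\<bar>s\<bar> + A) ^ d"
        proof (intro mult_mono power_mono)
          show "norm (E y) \<le> \<eta>"
            using minor[OF _ y] False by simp
          show "norm (of_real s + v y) \<le> \<bar>s\<bar> + A"
            using norm_triangle_ineq[of "of_real s" "v y"] v(1)[OF y] y by simp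
        qed (use nonneg in auto)
        then show ?thesis
          using True by (simp add: f_def norm_mult norm_power)
      qed (simp add: f_def)
      show ?thesis
        using norm_triangle_ineq4[of "f y" "gauss_power s d y"] 1 2 unfolding g_def by linarith
    qed
  qed
  have int_g: "has_bochner_integral lborel g (c * M * (2 * sqrt pi) + 2 * A * (\<eta> * (\<bar>s\<bar> + A) ^ d))"
  proof -
    have "has_bochner_integral lborel (\<lambda>y. indicator {-A..A} y :: real) (2 * A)"
      using has_bochner_integral_real_indicator[of "{-A..A}" lborel] T by simp
    then show ?thesis
      unfolding g_def
      by (intro has_bochner_integral_add has_bochner_integral_mult_right has_bochner_integral_mult_left
          has_bochner_integral_exp_quarter)
  qed
  have "(LBINT y:{-A..A}. E y * (of_real s + v y) ^ d) - of_real (sqrt (2 * pi) * poly (hermite d) s) =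
     (\<integral>y. f y - gauss_power s d y \<partial>lborel)"
    unfolding set_lebesgue_integral_def f_def[symmetric] integral_gauss_power[symmetric]
    by (rule Bochner_Integration.integral_diff[symmetric, OF int_f integrable_gauss_power])
  also have "norm \<dots> \<le> integral\<^sup>L lborel g"
    using int_g bound int_f integrable_gauss_power
    by (intro Bochner_Integration.integral_norm_bound_integral) (auto simp: has_bochner_integral_iff)
  also have "\<dots> = c * M * (2 * sqrt pi) + 2 * A * (\<eta> * (\<bar>s\<bar> + A) ^ d)"
    using int_g by (simp add: has_bochner_integral_iff)
  finally show ?thesis
    by (simp only: c_def M_def)
qed

section \<open>The generating function near and away from the saddle point\<close>

lemma norm_one_minus_ge:
  fixes u :: complex
  shows "1 - norm u \<le> norm (1 - u)"
  using norm_triangle_ineq2[of 1 u] by simp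

text \<open>Second-order Taylor expansion of -Ln (1 - u) with u = \<rho> e^(i z), along real z.
  There |u| = \<rho>, so 1 - u has positive real part, the principal branch is smooth, and |1 - u|
  >= 1 - \<rho> bounds the third derivative.\<close>

lemma geometric_cis_expansion:
  fixes \<rho> \<phi> :: real
  assumes \<rho>: "0 < \<rho>" "\<rho> < 1"
  shows "\<exists>w. 1 / (1 - rcis \<rho> \<phi>) =
      of_real (1 / (1 - \<rho>)) * exp (\<i> * of_real (\<phi> * (\<rho> / (1 - \<rho>))) - of_real (\<phi>\<^sup>2 * (\<rho> / (1 - \<rho>)\<^sup>2) / 2) + w) \<and>
      norm w \<le> \<bar>\<phi>\<bar> ^ 3 * (\<rho> * (1 + \<rho>) / (1 - \<rho>) ^ 3) / 2"
proof -
  define u where "u z = of_real \<rho> * exp (\<i> * z)" for z :: complex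
  \<comment> \<open>For i <= 3, \<open>f i\<close> is the i-th derivative with respect to z.\<close>
  define f where "f = (\<lambda>n::nat. if n = 0 then (\<lambda>z. - Ln (1 - u z))
      else if n = 1 then (\<lambda>z. \<i> * u z / (1 - u z))
      else if n = 2 then (\<lambda>z. - u z / (1 - u z)\<^sup>2)
      else (\<lambda>z. - \<i> * u z * (1 + u z) / (1 - u z) ^ 3))"
  have norm_u: "norm (u z) = \<rho>" if "z \<in> \<real>" for z
    using that \<rho> by (auto elim!: Reals_cases simp: u_def norm_mult)
  have Re_u: "0 < Re (1 - u z)" if "z \<in> \<real>" for z
    using complex_Re_le_cmod[of "u z"] norm_u[OF that] \<rho> by simp
  have ne: "1 - u z \<noteq> 0" if "z \<in> \<real>" for z
    using Re_u[OF that] by auto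
  have du: "(u has_field_derivative \<i> * u z) (at z)" for z
    unfolding u_def by (auto intro!: derivative_eq_intros)
  have deriv: "(f i has_field_derivative f (Suc i) z) (at z within \<real>)" if z: "z \<in> \<real>" and i: "i \<le> 2" for i z
  proof -
    note [derivative_intros] = DERIV_chain2[OF du]
    have nonpos: "1 - u z \<notin> \<real>\<^sub>\<le>\<^sub>0"
      using Re_u[OF z] by (simp add: complex_nonpos_Reals_iff)
    consider "i = 0" | "i = 1" | "i = 2"
      using i by linarith
    then have "(f i has_field_derivative f (Suc i) z) (at z)"
    proof cases
      case 1
      show ?thesis
        unfolding 1 f_def using nonpos ne[OF z]
        by (auto intro!: derivative_eq_intros du simp: field_simps)
    next
      case 2
      show ?thesis
        unfolding 2 f_def using ne[OF z]
        by (auto intro!: derivative_eq_intros du simp: field_simps power2_eq_square)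
    next
      case 3
      show ?thesis
        unfolding 3 f_def using ne[OF z]
        by (auto intro!: derivative_eq_intros du simp: divide_simps) (simp add: power2_eq_square power3_eq_cube power4_eq_xxxx algebra_simps)
    qed
    then show ?thesis
      by (rule has_field_derivative_at_within)
  qed
  have bound: "norm (f (Suc 2) z) \<le> \<rho> * (1 + \<rho>) / (1 - \<rho>) ^ 3" if "z \<in> \<real>" for z
  proof -
    have "norm (f (Suc 2) z) = \<rho> * norm (1 + u z) / norm (1 - u z) ^ 3"
      using norm_u[OF that] by (simp add: f_def norm_mult norm_divide norm_power)
    also have "\<dots> \<le> \<rho> * (1 + \<rho>) / (1 - \<rho>) ^ 3"
      using \<rho> norm_triangle_ineq[of 1 "u z"] norm_u[OF that] norm_one_minus_ge[of "u z"]
      by (intro frac_le mult_left_mono power_mono mult_nonneg_nonneg) auto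
    finally show ?thesis .
  qed
  define w where "w = f 0 (of_real \<phi>) - (\<Sum>i\<le>2. f i 0 * (of_real \<phi> - 0) ^ i / fact i)"
  \<comment> \<open>The remainder in \<open>complex_Taylor\<close> carries 1/2! rather than 1/3!,
    hence the factor 1/2 in the bound.\<close>
  have "norm w \<le> \<rho> * (1 + \<rho>) / (1 - \<rho>) ^ 3 * norm (of_real \<phi> - (0::complex)) ^ Suc 2 / fact 2"
    unfolding w_def using deriv bound by (intro complex_Taylor[of "\<real>"]) (auto simp: convex_Reals)
  then have w: "norm w \<le> \<bar>\<phi>\<bar> ^ 3 * (\<rho> * (1 + \<rho>) / (1 - \<rho>) ^ 3) / 2"
    by (simp add: mult_ac eval_nat_numeral)
  have Ln: "Ln (1 - of_real \<rho>) = of_real (ln (1 - \<rho>))"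
    using \<rho> Ln_of_real[of "1 - \<rho>"] by simp
  have "f 0 (of_real \<phi>) = - of_real (ln (1 - \<rho>)) +
      (\<i> * of_real (\<phi> * (\<rho> / (1 - \<rho>))) - of_real (\<phi>\<^sup>2 * (\<rho> / (1 - \<rho>)\<^sup>2) / 2) + w)"
    by (simp add: w_def f_def u_def Ln eval_nat_numeral)
  moreover have "exp (f 0 (of_real \<phi>)) = 1 / (1 - rcis \<rho> \<phi>)"
    using ne[of "of_real \<phi>"] by (simp add: f_def exp_minus u_def rcis_def cis_conv_exp inverse_eq_divide)
  moreover have "exp (- complex_of_real (ln (1 - \<rho>))) = of_real (1 / (1 - \<rho>))"
    using \<rho> by (simp add: exp_minus exp_of_real inverse_eq_divide flip: of_real_minus) 
  ultimately have "1 / (1 - rcis \<rho> \<phi>) =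
      of_real (1 / (1 - \<rho>)) * exp (\<i> * of_real (\<phi> * (\<rho> / (1 - \<rho>))) - of_real (\<phi>\<^sup>2 * (\<rho> / (1 - \<rho>)\<^sup>2) / 2) + w)"
    by (metis exp_add)
  with w show ?thesis
    by blast
qed

text \<open>This and the next two definitions are the first three derivatives of log F(r e^x) at x =
  0: the cumulants of the sum of k X_k over k <= N with independent geometric X_k of ratio r^k.
  \<open>gf_third\<close> also dominates the third derivative on the whole circle.\<close>

definition gf_mean :: "nat \<Rightarrow> real \<Rightarrow> real" where
  "gf_mean N r = (\<Sum>k=1..N. real k * (r ^ k / (1 - r ^ k)))"

definition gf_variance :: "nat \<Rightarrow> real \<Rightarrow> real" where
  "gf_variance N r = (\<Sum>k=1..N. real k ^ 2 * (r ^ k / (1 - r ^ k)\<^sup>2))"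

definition gf_third :: "nat \<Rightarrow> real \<Rightarrow> real" where
  "gf_third N r = (\<Sum>k=1..N. real k ^ 3 * (r ^ k * (1 + r ^ k) / (1 - r ^ k) ^ 3))"

lemma partition_gf_Suc: "partition_gf (Suc N) q = partition_gf N q * (1 / (1 - q ^ Suc N))"
  by (simp add: partition_gf_def del: power_Suc)

text \<open>The factor with index k is the preceding expansion at \<rho> = r^k and \<phi> = k
  \<theta>, so the exponents add up to the cumulants.\<close>

lemma partition_gf_expansion:
  assumes r: "0 < r" "r < 1"
  shows "\<exists>w. partition_gf N (rcis r \<theta>) = partition_gf N (of_real r) *
      exp (\<i> * of_real (\<theta> * gf_mean N r) - of_real (\<theta>\<^sup>2 * gf_variance N r / 2) + w) \<and>
      norm w \<le> \<bar>\<theta>\<bar> ^ 3 * gf_third N r / 2"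
proof (induction N)
  case 0
  show ?case
    by (intro exI[of _ 0]) (simp add: partition_gf_def gf_mean_def gf_variance_def gf_third_def)
next
  case (Suc N)
  let ?\<rho> = "r ^ Suc N" and ?k = "real (Suc N)"
  let ?e = "\<lambda>N w. \<i> * of_real (\<theta> * gf_mean N r) - of_real (\<theta>\<^sup>2 * gf_variance N r / 2) + w"
  obtain w where w: "partition_gf N (rcis r \<theta>) = partition_gf N (of_real r) * exp (?e N w)"
      "norm w \<le> \<bar>\<theta>\<bar> ^ 3 * gf_third N r / 2"
    using Suc.IH by blast
  have \<rho>: "0 < ?\<rho>" "?\<rho> < 1"
    using r by (auto simp: power_less_one_iff simp del: power_Suc)
  let ?e' = "\<lambda>w. \<i> * of_real (?k * \<theta> * (?\<rho> / (1 - ?\<rho>))) - of_real ((?k * \<theta>)\<^sup>2 * (?\<rho> / (1 - ?\<rho>)\<^sup>2) / 2) + w"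
  obtain w' where w': "1 / (1 - rcis ?\<rho> (?k * \<theta>)) = of_real (1 / (1 - ?\<rho>)) * exp (?e' w')"
      "norm w' \<le> \<bar>?k * \<theta>\<bar> ^ 3 * (?\<rho> * (1 + ?\<rho>) / (1 - ?\<rho>) ^ 3) / 2"
    using geometric_cis_expansion[OF \<rho>, of "?k * \<theta>"] by blast
  have e: "?e N w + ?e' w' = ?e (Suc N) (w + w')"
    by (simp add: gf_mean_def gf_variance_def algebra_simps power_mult_distrib add_divide_distrib del: power_Suc of_nat_Suc)
  have "partition_gf (Suc N) (rcis r \<theta>) = partition_gf N (rcis r \<theta>) * (1 / (1 - rcis ?\<rho> (?k * \<theta>)))"
    by (simp only: partition_gf_Suc DeMoivre2)
  also have "\<dots> = partition_gf N (of_real r) * of_real (1 / (1 - ?\<rho>)) * (exp (?e N w) * exp (?e' w'))"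
    by (simp only: w(1) w'(1)) (simp only: mult_ac)
  also have "partition_gf N (of_real r) * of_real (1 / (1 - ?\<rho>)) = partition_gf (Suc N) (of_real r)"
    by (simp add: partition_gf_Suc del: power_Suc)
  also have "exp (?e N w) * exp (?e' w') = exp (?e (Suc N) (w + w'))"
    by (simp only: exp_add[symmetric] e)
  finally have 1: "partition_gf (Suc N) (rcis r \<theta>) = partition_gf (Suc N) (of_real r) * exp (?e (Suc N) (w + w'))" .
  have "norm (w + w') \<le> \<bar>\<theta>\<bar> ^ 3 * gf_third N r / 2 + \<bar>?k * \<theta>\<bar> ^ 3 * (?\<rho> * (1 + ?\<rho>) / (1 - ?\<rho>) ^ 3) / 2"
    by (rule norm_triangle_le[OF add_mono[OF w(2) w'(2)]])
  also have "\<dots> = \<bar>\<theta>\<bar> ^ 3 * gf_third (Suc N) r / 2"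
    by (simp add: gf_third_def abs_mult power_mult_distrib algebra_simps add_divide_distrib del: power_Suc of_nat_Suc)
  finally show ?case
    using 1 by blast
qed

section \<open>Decay away from the saddle point\<close>

lemma norm_one_minus_rcis_square:
  "(norm (1 - rcis \<rho> \<phi>))\<^sup>2 = (1 - \<rho>)\<^sup>2 + 2 * \<rho> * (1 - cos \<phi>)"
proof -
  have "(norm (1 - rcis \<rho> \<phi>))\<^sup>2 = (1 - \<rho> * cos \<phi>)\<^sup>2 + (\<rho> * sin \<phi>)\<^sup>2"
    unfolding cmod_power2 by simp
  also have "\<dots> = 1 - 2 * \<rho> * cos \<phi> + \<rho>\<^sup>2 * ((sin \<phi>)\<^sup>2 + (cos \<phi>)\<^sup>2)"
    by algebra
  also have "(sin \<phi>)\<^sup>2 + (cos \<phi>)\<^sup>2 = 1"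
    by (rule sin_cos_squared_add)
  finally show ?thesis
    by (simp add: power2_eq_square algebra_simps)
qed

text \<open>With y = 2 \<rho> (1 - cos \<phi>), the squared modulus is (1 - \<rho>)^2 + y >= (1 -
  \<rho>)^2 (1 + y), and 1 + y >= exp (y / (1 + y)) >= exp (y / 5) because y <= 4.\<close>

lemma norm_inverse_one_minus_rcis_le:
  assumes \<rho>: "0 < \<rho>" "\<rho> < 1"
  shows "norm (1 / (1 - rcis \<rho> \<phi>)) \<le> 1 / (1 - \<rho>) * exp (- (\<rho> * (1 - cos \<phi>) / 5))"
proof -
  define y where "y = 2 * \<rho> * (1 - cos \<phi>)"
  have y: "0 \<le> y" "y \<le> 4"
  proof -
    show "0 \<le> y"
      using \<rho> by (simp add: y_def)
    have "y \<le> 2 * 1 * 2"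
      unfolding y_def using \<rho> cos_ge_minus_one[of \<phi>] by (intro mult_mono) auto
    then show "y \<le> 4"
      by simp
  qed
  have "1 / (1 + y) \<le> exp (- (y / (1 + y)))"
    using exp_ge_add_one_self[of "- (y / (1 + y))"] y by (simp add: field_simps)
  also have "y / 5 \<le> y / (1 + y)"
    using y by (intro frac_le) auto
  then have "exp (- (y / (1 + y))) \<le> exp (- (y / 5))"
    by simp
  finally have "exp (y / 5) \<le> 1 + y"
    using y by (simp add: exp_minus field_simps)
  have sq: "((1 - \<rho>) * exp (\<rho> * (1 - cos \<phi>) / 5))\<^sup>2 \<le> (norm (1 - rcis \<rho> \<phi>))\<^sup>2"
  proof -
    have "((1 - \<rho>) * exp (\<rho> * (1 - cos \<phi>) / 5))\<^sup>2 = (1 - \<rho>)\<^sup>2 * exp (y / 5)"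
      by (simp add: power_mult_distrib y_def flip: exp_of_nat_mult)
    also have "\<dots> \<le> (1 - \<rho>)\<^sup>2 * (1 + y)"
      using \<open>exp (y / 5) \<le> 1 + y\<close> by (intro mult_left_mono) auto
    also have "\<dots> \<le> (1 - \<rho>)\<^sup>2 + y"
      using \<rho> y mult_right_mono[of "(1 - \<rho>)\<^sup>2" 1 y] by (simp add: algebra_simps power_le_one)
    finally show ?thesis
      by (simp add: norm_one_minus_rcis_square y_def)
  qed
  have "(1 - \<rho>) * exp (\<rho> * (1 - cos \<phi>) / 5) \<le> norm (1 - rcis \<rho> \<phi>)"
    by (rule power2_le_imp_le[OF sq]) simp
  moreover have "0 < (1 - \<rho>) * exp (\<rho> * (1 - cos \<phi>) / 5)"
    using \<rho> by simp
  ultimately have "1 / norm (1 - rcis \<rho> \<phi>) \<le> 1 / ((1 - \<rho>) * exp (\<rho> * (1 - cos \<phi>) / 5))"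
    by (intro frac_le) simp_all
  also have "\<dots> = 1 / (1 - \<rho>) * exp (- (\<rho> * (1 - cos \<phi>) / 5))"
    by (simp only: exp_minus inverse_eq_divide times_divide_eq_right times_divide_eq_left mult_1_right divide_divide_eq_left)
  finally show ?thesis
    by (simp only: norm_divide norm_one)
qed

lemma norm_partition_gf_le:
  assumes r: "0 < r" "r < 1"
  shows "norm (partition_gf N (rcis r \<theta>)) \<le>
    norm (partition_gf N (of_real r)) * exp (- ((\<Sum>k=1..N. r ^ k * (1 - cos (real k * \<theta>))) / 5))"
proof -
  have *: "0 < r ^ k" "r ^ k < 1" if "k \<in> {1..N}" for k
    using r that by (auto simp: power_less_one_iff)
  have "norm (partition_gf N (rcis r \<theta>)) = (\<Prod>k=1..N. norm (1 / (1 - rcis (r ^ k) (real k * \<theta>))))"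
    by (simp only: partition_gf_def DeMoivre2 prod_norm[symmetric])
  also have "\<dots> \<le> (\<Prod>k=1..N. 1 / (1 - r ^ k) * exp (- (r ^ k * (1 - cos (real k * \<theta>)) / 5)))"
    using * by (intro prod_mono conjI norm_inverse_one_minus_rcis_le norm_ge_zero)
  also have "\<dots> = (\<Prod>k=1..N. 1 / (1 - r ^ k)) * exp (\<Sum>k=1..N. - (r ^ k * (1 - cos (real k * \<theta>)) / 5))"
    by (simp only: prod.distrib exp_sum finite_atLeastAtMost)
  also have "(\<Prod>k=1..N. 1 / (1 - r ^ k)) = (\<Prod>k=1..N. norm (1 / (1 - complex_of_real r ^ k)))"
  proof (rule prod.cong[OF refl])
    fix k assume "k \<in> {1..N}"
    have "1 - complex_of_real r ^ k = of_real (1 - r ^ k)"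
      by simp
    then have "norm (1 / (1 - complex_of_real r ^ k)) = 1 / \<bar>1 - r ^ k\<bar>"
      by (simp only: norm_divide norm_one norm_of_real)
    then show "1 / (1 - r ^ k) = norm (1 / (1 - complex_of_real r ^ k))"
      using *[OF \<open>k \<in> {1..N}\<close>] by simp
  qed
  also have "\<dots> = norm (partition_gf N (of_real r))"
    by (simp only: partition_gf_def prod_norm)
  also have "(\<Sum>k=1..N. - (r ^ k * (1 - cos (real k * \<theta>)) / 5)) = - ((\<Sum>k=1..N. r ^ k * (1 - cos (real k * \<theta>))) / 5)"
    by (simp add: sum_negf sum_divide_distrib)
  finally show ?thesis .
qed

lemma partition_gf_of_real:
  "partition_gf N (of_real r) = of_real (\<Prod>k=1..N. 1 / (1 - r ^ k))"
  by (simp add: partition_gf_def)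

text \<open>Difference of the geometric sums at r and at r e^(i \<theta>): the full series give the
  main term, and each of the two tails beyond N costs at most r^(N+1) / (1 - r).\<close>

lemma sum_one_minus_cos_ge:
  assumes r: "0 < r" "r < 1"
  shows "r * (1 / (1 - r) - 1 / norm (1 - rcis r \<theta>)) - 2 * r ^ Suc N / (1 - r)
     \<le> (\<Sum>k=1..N. r ^ k * (1 - cos (real k * \<theta>)))"
proof -
  define q where "q = rcis r \<theta>"
  have nq: "norm q = r"
    using r by (simp add: q_def)
  have qne: "1 - q \<noteq> 0"
    using one_minus_power_nonzero[of q 1] r by (simp add: nq)
  have geo: "(\<Sum>k=1..N. z ^ k) = (z - z ^ Suc N) / (1 - z)" if "1 - z \<noteq> 0" for z :: "'a::field"
  proof -
    have "(\<Sum>k=1..N. z ^ k) * (1 - z) = z - z ^ Suc N"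
    proof (induction N)
      case (Suc N)
      have "(\<Sum>k=1..Suc N. z ^ k) * (1 - z) = (\<Sum>k=1..N. z ^ k) * (1 - z) + z ^ Suc N * (1 - z)"
        by (simp add: distrib_right)
      also have "\<dots> = z - z ^ Suc (Suc N)"
        unfolding Suc.IH by (simp add: algebra_simps)
      finally show ?case .
    qed simp
    then show ?thesis
      using that by (simp add: eq_divide_eq)
  qed
  have geo_r: "(\<Sum>k=1..N. r ^ k) = (r - r ^ Suc N) / (1 - r)"
    using r by (intro geo) simp
  have le: "1 - r \<le> norm (1 - q)"
    using norm_one_minus_ge[of q] nq by simp
  have "Re (\<Sum>k=1..N. q ^ k) \<le> norm ((q - q ^ Suc N) / (1 - q))"
    unfolding geo[OF qne] by (rule complex_Re_le_cmod)
  also have "\<dots> \<le> (r + r ^ Suc N) / norm (1 - q)"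
    unfolding norm_divide using norm_triangle_ineq4[of q "q ^ Suc N"]
    by (intro divide_right_mono) (auto simp: norm_power nq norm_mult)
  also have "\<dots> \<le> r / norm (1 - q) + r ^ Suc N / (1 - r)"
    unfolding add_divide_distrib using r le by (intro add_left_mono divide_left_mono mult_pos_pos) auto
  finally have "(\<Sum>k=1..N. r ^ k) - Re (\<Sum>k=1..N. q ^ k) \<ge>
      (r - r ^ Suc N) / (1 - r) - (r / norm (1 - q) + r ^ Suc N / (1 - r))"
    unfolding geo_r by linarith
  moreover have "(\<Sum>k=1..N. r ^ k * (1 - cos (real k * \<theta>))) = (\<Sum>k=1..N. r ^ k) - Re (\<Sum>k=1..N. q ^ k)"
    by (simp add: q_def DeMoivre2 algebra_simps sum_subtractf)
  ultimately show ?thesis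
    unfolding q_def[symmetric] by (simp add: right_diff_distrib diff_divide_distrib)
qed

section \<open>Elementary estimates for exponential sums\<close>

lemma one_minus_cos_ge:
  fixes x :: real
  assumes "\<bar>x\<bar> \<le> 1"
  shows "x\<^sup>2 / 3 \<le> 1 - cos x"
proof -
  have "norm (exp (\<i> * x) - (\<Sum>k\<le>2. (\<i> * x) ^ k / fact k)) \<le> \<bar>x\<bar> ^ Suc 2 / fact (Suc 2)"
    by (rule iexp_approx1)
  moreover have "Re (exp (\<i> * x) - (\<Sum>k\<le>2. (\<i> * x) ^ k / fact k)) = cos x - (1 - x\<^sup>2 / 2)"
    by (simp add: eval_nat_numeral Re_exp power2_eq_square)
  ultimately have "\<bar>cos x - (1 - x\<^sup>2 / 2)\<bar> \<le> \<bar>x\<bar> ^ 3 / 6"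
    using abs_Re_le_cmod[of "exp (\<i> * x) - (\<Sum>k\<le>2. (\<i> * x) ^ k / fact k)"]
    by (simp add: eval_nat_numeral)
  moreover have "\<bar>x\<bar> ^ 3 \<le> x\<^sup>2"
    using power_decreasing[of 2 3 "\<bar>x\<bar>"] assms by simp
  ultimately show ?thesis
    by linarith
qed

lemma one_minus_exp_ge:
  fixes x :: real
  assumes "0 < x"
  shows "x / (1 + x) \<le> 1 - exp (- x)"
proof -
  have "exp (- x) \<le> 1 / (1 + x)"
    using exp_ge_add_one_self[of x] assms by (simp add: exp_minus inverse_eq_divide frac_le)
  then show ?thesis
    using assms by (simp add: field_simps)
qed

lemma mult_exp_minus_le:
  fixes x c :: real
  assumes "0 < x" "1 \<le> c"
  shows "x * exp (- (x / c)) \<le> c * (1 - exp (- x))"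
proof -
  have "1 + x / c \<le> exp (x / c)"
    by (rule exp_ge_add_one_self)
  then have "exp (- (x / c)) \<le> 1 / (1 + x / c)"
    using assms by (simp add: exp_minus inverse_eq_divide frac_le add_pos_pos)
  also have "\<dots> = c / (c + x)"
    using assms by (simp add: field_simps)
  also have "\<dots> \<le> c / (1 + x)"
    using assms by (intro divide_left_mono) auto
  finally have "x * exp (- (x / c)) \<le> x * (c / (1 + x))"
    using assms by (intro mult_left_mono) auto
  also have "\<dots> = c * (x / (1 + x))"
    by simp
  also have "\<dots> \<le> c * (1 - exp (- x))"
    using assms by (intro mult_left_mono one_minus_exp_ge) auto
  finally show ?thesis .
qed

text \<open>The previous inequality with c = 2 m: half of the decay exp (-x) is spent on replacing 1
  - exp (-x) by x, the other half remains for the summation over k.\<close>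

lemma exp_minus_div_power_le:
  fixes x :: real
  assumes "0 < x" "0 < m"
  shows "exp (- x) / (1 - exp (- x)) ^ m \<le> (2 * real m) ^ m / x ^ m * exp (- (x / 2))"
proof -
  have "(x * exp (- (x / (2 * real m)))) ^ m \<le> (2 * real m * (1 - exp (- x))) ^ m"
    using assms by (intro power_mono mult_exp_minus_le) auto
  moreover have "exp (- (x / (2 * real m))) ^ m = exp (- (x / 2))"
    using assms by (simp flip: exp_of_nat_mult)
  ultimately have le: "x ^ m * exp (- (x / 2)) \<le> (2 * real m) ^ m * (1 - exp (- x)) ^ m"
    by (simp add: power_mult_distrib)
  have pos: "0 < (1 - exp (- x)) ^ m"
    using assms by simp
  have "exp (- x) = exp (- (x / 2)) * exp (- (x / 2))"
    by (simp flip: exp_add)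
  then have "exp (- x) / (1 - exp (- x)) ^ m = x ^ m * exp (- (x / 2)) / (1 - exp (- x)) ^ m / x ^ m * exp (- (x / 2))"
    using assms by simp
  also have "\<dots> \<le> (2 * real m) ^ m / x ^ m * exp (- (x / 2))"
    using le pos assms by (intro mult_right_mono divide_right_mono) (auto simp: pos_divide_le_eq)
  finally show ?thesis .
qed

lemma sum_exp_minus_eq:
  fixes s :: real
  assumes "0 < s"
  shows "(\<Sum>k=1..N. exp (- (real k * s))) = exp (- s) * (1 - exp (- (real N * s))) / (1 - exp (- s))"
proof -
  have "(\<Sum>k=1..N. exp (- (real k * s))) * (1 - exp (- s)) = exp (- s) * (1 - exp (- (real N * s)))"
  proof (induction N)
    case (Suc N)
    have "(\<Sum>k=1..Suc N. exp (- (real k * s))) * (1 - exp (- s)) =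
        (\<Sum>k=1..N. exp (- (real k * s))) * (1 - exp (- s)) + exp (- (real (Suc N) * s)) * (1 - exp (- s))"
      by (simp add: distrib_right)
    also have "\<dots> = exp (- s) * (1 - exp (- (real (Suc N) * s)))"
      unfolding Suc.IH by (simp add: algebra_simps flip: exp_add)
    finally show ?case .
  qed simp
  moreover have "1 - exp (- s) \<noteq> 0"
    using assms by simp
  ultimately show ?thesis
    by (simp add: eq_divide_eq)
qed

lemma sum_exp_minus_le:
  fixes s :: real
  assumes "0 < s"
  shows "(\<Sum>k=1..N. exp (- (real k * s))) \<le> 1 / s"
proof -
  have "exp (- s) * (1 - exp (- (real N * s))) \<le> exp (- s) * 1"
    by (intro mult_left_mono) auto
  also have "exp (- s) * s \<le> 1 - exp (- s)"
  proof -
    have "exp (- s) * (1 + s) \<le> exp (- s) * exp s"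
      by (intro mult_left_mono exp_ge_add_one_self) auto
    then show ?thesis
      by (simp add: algebra_simps flip: exp_add)
  qed
  then have "exp (- s) * 1 \<le> (1 - exp (- s)) * (1 / s)"
    using assms by (simp add: field_simps)
  finally show ?thesis
    unfolding sum_exp_minus_eq[OF assms] using assms by (simp add: pos_divide_le_eq mult.commute)
qed

text \<open>N s >= 2 keeps the loss by truncation below a third, and s <= 1/2 keeps exp (-s) >=
  1/2.\<close>

lemma sum_exp_minus_ge:
  fixes s :: real
  assumes "0 < s" "s \<le> 1 / 2" "2 \<le> real N * s"
  shows "1 / (3 * s) \<le> (\<Sum>k=1..N. exp (- (real k * s)))"
proof -
  have "exp (- (real N * s)) \<le> 1 / 3"
  proof -
    have "3 \<le> exp (real N * s)"
      using exp_ge_add_one_self[of "real N * s"] assms by linarith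
    then show ?thesis
      by (simp add: exp_minus inverse_eq_divide field_simps)
  qed
  then have "exp (- s) * (2 / 3) \<le> exp (- s) * (1 - exp (- (real N * s)))"
    by (intro mult_left_mono) auto
  moreover have "(1 - exp (- s)) * (1 / (3 * s)) \<le> exp (- s) * (2 / 3)"
  proof -
    have "1 - s \<le> exp (- s)"
      using exp_ge_add_one_self[of "- s"] by simp
    then have "1 - exp (- s) \<le> 2 * s * (1 / 2)" and "1 / 2 \<le> exp (- s)"
      using assms by linarith+
    then have "1 - exp (- s) \<le> 2 * s * exp (- s)"
      using mult_left_mono[of "1 / 2" "exp (- s)" "2 * s"] assms by linarith
    then show ?thesis
      using assms by (simp add: field_simps)
  qed
  ultimately have "(1 - exp (- s)) * (1 / (3 * s)) \<le> exp (- s) * (1 - exp (- (real N * s)))"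
    by (rule order_trans[rotated])
  then show ?thesis
    unfolding sum_exp_minus_eq[OF assms(1)] using assms by (simp add: pos_le_divide_eq mult.commute)
qed

section \<open>Orders of magnitude at the radius e^-t\<close>

context
  fixes t :: real and N :: nat
  assumes t: "0 < t"
begin

lemma exp_minus_power: "exp (- t) ^ k = exp (- (real k * t))"
  by (simp flip: exp_of_nat_mult)

lemma gf_term_le:
  assumes "0 < m" "0 < k"
  shows "real k ^ m * (exp (- t) ^ k / (1 - exp (- t) ^ k) ^ m) \<le> (2 * real m) ^ m / t ^ m * exp (- (real k * (t / 2)))"
proof -
  have "real k ^ m * (exp (- (real k * t)) / (1 - exp (- (real k * t))) ^ m) \<le>
      real k ^ m * ((2 * real m) ^ m / (real k * t) ^ m * exp (- (real k * t / 2)))"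
    using assms t by (intro mult_left_mono exp_minus_div_power_le) auto
  also have "\<dots> = (2 * real m) ^ m / t ^ m * exp (- (real k * (t / 2)))"
    using assms by (simp add: power_mult_distrib)
  finally show ?thesis
    by (simp only: exp_minus_power)
qed

text \<open>About 1/t indices matter, each contributing order t^-m. The cases m = 1, 2, 3 serve the
  three cumulants.\<close>

lemma gf_sum_le:
  assumes "0 < m"
  shows "(\<Sum>k=1..N. real k ^ m * (exp (- t) ^ k / (1 - exp (- t) ^ k) ^ m)) \<le> 2 * (2 * real m) ^ m / t ^ Suc m"
proof -
  have "(\<Sum>k=1..N. real k ^ m * (exp (- t) ^ k / (1 - exp (- t) ^ k) ^ m)) \<le>
      (\<Sum>k=1..N. (2 * real m) ^ m / t ^ m * exp (- (real k * (t / 2))))"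
    using assms by (intro sum_mono gf_term_le) auto
  also have "\<dots> = (2 * real m) ^ m / t ^ m * (\<Sum>k=1..N. exp (- (real k * (t / 2))))"
    by (simp only: sum_distrib_left)
  also have "\<dots> \<le> (2 * real m) ^ m / t ^ m * (1 / (t / 2))"
    using t by (intro mult_left_mono sum_exp_minus_le) auto
  finally show ?thesis
    by (simp add: mult_ac)
qed

lemma gf_mean_le: "gf_mean N (exp (- t)) \<le> 4 / t\<^sup>2"
  using gf_sum_le[of 1] by (simp add: gf_mean_def eval_nat_numeral)

lemma gf_variance_le: "gf_variance N (exp (- t)) \<le> 32 / t ^ 3"
  using gf_sum_le[of 2] by (simp add: gf_variance_def eval_nat_numeral)

lemma gf_third_le: "gf_third N (exp (- t)) \<le> 864 / t ^ 4"
proof -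
  have "gf_third N (exp (- t)) \<le> (\<Sum>k=1..N. 2 * (real k ^ 3 * (exp (- t) ^ k / (1 - exp (- t) ^ k) ^ 3)))"
    unfolding gf_third_def
  proof (intro sum_mono)
    fix k
    let ?\<rho> = "exp (- t) ^ k"
    have "?\<rho> \<le> 1"
      using t by (simp add: power_le_one)
    then have "?\<rho> * (1 + ?\<rho>) / (1 - ?\<rho>) ^ 3 \<le> ?\<rho> * 2 / (1 - ?\<rho>) ^ 3"
      by (intro divide_right_mono mult_left_mono) auto
    then have "real k ^ 3 * (?\<rho> * (1 + ?\<rho>) / (1 - ?\<rho>) ^ 3) \<le> real k ^ 3 * (?\<rho> * 2 / (1 - ?\<rho>) ^ 3)"
      by (intro mult_left_mono) auto
    then show "real k ^ 3 * (?\<rho> * (1 + ?\<rho>) / (1 - ?\<rho>) ^ 3) \<le> 2 * (real k ^ 3 * (?\<rho> / (1 - ?\<rho>) ^ 3))"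
      by (simp add: mult_ac)
  qed
  also have "\<dots> \<le> 2 * (2 * (2 * real 3) ^ 3 / t ^ Suc 3)"
    unfolding sum_distrib_left[symmetric] by (intro mult_left_mono gf_sum_le) auto
  finally show ?thesis
    by (simp add: eval_nat_numeral)
qed

text \<open>Since 1 - exp (-k t) <= k t, each term is at least t^-m exp (-k t).\<close>

lemma gf_sum_ge:
  assumes "t \<le> 1 / 2" "2 \<le> real N * t"
  shows "1 / (3 * t ^ Suc m) \<le> (\<Sum>k=1..N. real k ^ m * (exp (- t) ^ k / (1 - exp (- t) ^ k) ^ m))"
proof -
  have "1 / (3 * t ^ Suc m) = 1 / t ^ m * (1 / (3 * t))"
    by simp
  also have "\<dots> \<le> 1 / t ^ m * (\<Sum>k=1..N. exp (- (real k * t)))"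
    using assms t by (intro mult_left_mono sum_exp_minus_ge) auto
  also have "\<dots> = (\<Sum>k=1..N. 1 / t ^ m * exp (- (real k * t)))"
    by (simp only: sum_distrib_left)
  also have "\<dots> \<le> (\<Sum>k=1..N. real k ^ m * (exp (- t) ^ k / (1 - exp (- t) ^ k) ^ m))"
  proof (intro sum_mono)
    fix k assume "k \<in> {1..N}"
    then have k: "0 < real k * t" "k \<noteq> 0"
      using t by auto
    have "1 - exp (- (real k * t)) \<le> real k * t"
      using exp_ge_add_one_self[of "- (real k * t)"] by simp
    then have "(1 - exp (- (real k * t))) ^ m \<le> (real k * t) ^ m"
      using k by (intro power_mono) auto
    then have "exp (- (real k * t)) / (real k * t) ^ m \<le> exp (- (real k * t)) / (1 - exp (- (real k * t))) ^ m"
      using k by (intro divide_left_mono) auto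
    then have "real k ^ m * (exp (- (real k * t)) / (real k * t) ^ m) \<le>
        real k ^ m * (exp (- (real k * t)) / (1 - exp (- (real k * t))) ^ m)"
      by (intro mult_left_mono) auto
    moreover have "real k ^ m * (exp (- (real k * t)) / (real k * t) ^ m) = 1 / t ^ m * exp (- (real k * t))"
      using k by (simp add: power_mult_distrib)
    ultimately show "1 / t ^ m * exp (- (real k * t)) \<le> real k ^ m * (exp (- t) ^ k / (1 - exp (- t) ^ k) ^ m)"
      by (simp only: exp_minus_power)
  qed
  finally show ?thesis .
qed

lemma gf_mean_ge:
  assumes "t \<le> 1 / 2" "2 \<le> real N * t"
  shows "1 / (3 * t\<^sup>2) \<le> gf_mean N (exp (- t))"
  using gf_sum_ge[OF assms, of 1] by (simp add: gf_mean_def eval_nat_numeral)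

lemma gf_variance_ge:
  assumes "t \<le> 1 / 2" "2 \<le> real N * t"
  shows "1 / (3 * t ^ 3) \<le> gf_variance N (exp (- t))"
  using gf_sum_ge[OF assms, of 2] by (simp add: gf_variance_def eval_nat_numeral)

text \<open>With a = 1 - r of order t, |\<theta>| >= \<theta>0 raises |1 - q|^2 from a^2 to at least
  a^2 + \<theta>0^2/3, so 1/a - 1/|1 - q| has order at least \<theta>0^2 / t^3. The condition 64 t^3
  <= \<theta>0^2 lets half of this gain pay for the truncation at N.\<close>

lemma sum_one_minus_cos_lower_bound:
  assumes t': "t \<le> 1 / 192" and N: "1 / (4 * t) \<le> real N * t"
    and \<theta>0: "0 < \<theta>0" "\<theta>0 \<le> t" "64 * t ^ 3 \<le> \<theta>0\<^sup>2" and \<theta>: "\<theta>0 \<le> \<bar>\<theta>\<bar>" "\<bar>\<theta>\<bar> \<le> pi"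
  shows "\<theta>0\<^sup>2 / (64 * t ^ 3) \<le> (\<Sum>k=1..N. exp (- t) ^ k * (1 - cos (real k * \<theta>)))"
proof -
  define r where "r = exp (- t)"
  define a where "a = 1 - r"
  define b where "b = \<theta>0\<^sup>2 / 3"
  have r: "0 < r" "r < 1"
    using t by (auto simp: r_def)
  have r_ge: "1 / 2 \<le> r"
    using exp_ge_add_one_self[of "- t"] t' by (simp add: r_def)
  have a: "2 * t / 3 \<le> a" "a \<le> t" "0 < a"
  proof -
    have "2 * t / 3 \<le> t / (1 + t)"
      using t t' by (simp add: field_simps)
    then show "2 * t / 3 \<le> a"
      unfolding a_def r_def using one_minus_exp_ge[OF t] by (rule order_trans)
    show "a \<le> t"
      using exp_ge_add_one_self[of "- t"] by (simp add: a_def r_def)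
    show "0 < a"
      using r by (simp add: a_def)
  qed
  have b: "0 < b" "b \<le> a\<^sup>2"
  proof -
    show "0 < b"
      using \<theta>0 by (simp add: b_def)
    have "\<theta>0\<^sup>2 \<le> t\<^sup>2"
      using \<theta>0 by (intro power_mono) auto
    moreover have "(2 * t / 3)\<^sup>2 \<le> a\<^sup>2"
      using a t by (intro power_mono) auto
    moreover have "(2 * t / 3)\<^sup>2 = 4 / 9 * t\<^sup>2"
      by (simp add: power2_eq_square)
    ultimately show "b \<le> a\<^sup>2"
      using zero_le_power2[of t] unfolding b_def by linarith
  qed
  \<comment> \<open>(1 + y/3)^2 <= 1 + y for 0 <= y <= 1, used with y = b / a^2, linearises the
    square root.\<close>
  have norm_ge: "a * (1 + b / a\<^sup>2 / 3) \<le> norm (1 - rcis r \<theta>)"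
  proof (rule power2_le_imp_le)
    have "cos \<theta> \<le> cos \<theta>0"
      using cos_monotone_0_pi_le[of \<theta>0 "\<bar>\<theta>\<bar>"] \<theta> \<theta>0 by (simp add: cos_abs_real)
    then have "b \<le> 1 - cos \<theta>"
      using one_minus_cos_ge[of \<theta>0] \<theta>0 t' by (simp add: b_def)
    also have "\<dots> \<le> 2 * r * (1 - cos \<theta>)"
      using r_ge mult_right_mono[of 1 "2 * r" "1 - cos \<theta>"] by simp
    finally have "a\<^sup>2 + b \<le> (norm (1 - rcis r \<theta>))\<^sup>2"
      by (simp add: norm_one_minus_rcis_square a_def)
    moreover have "(a * (1 + b / a\<^sup>2 / 3))\<^sup>2 = a\<^sup>2 + b * (2 / 3 + b / a\<^sup>2 / 9)"
      using a by (simp add: power2_eq_square field_simps)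
    moreover have "b * (2 / 3 + b / a\<^sup>2 / 9) \<le> b * 1"
      using b a by (intro mult_left_mono) (auto simp: field_simps)
    ultimately show "(a * (1 + b / a\<^sup>2 / 3))\<^sup>2 \<le> (norm (1 - rcis r \<theta>))\<^sup>2"
      by linarith
  qed simp
  have main: "\<theta>0\<^sup>2 / (32 * t ^ 3) \<le> r * (1 / a - 1 / norm (1 - rcis r \<theta>))"
  proof -
    define y where "y = b / a\<^sup>2"
    have y: "0 < y" "y \<le> 1"
      using b a by (auto simp: y_def)
    have "\<theta>0\<^sup>2 / (32 * t ^ 3) \<le> 1 / 2 * (\<theta>0\<^sup>2 / (12 * t ^ 3))"
      using t by (simp add: field_simps)
    also have "\<theta>0\<^sup>2 / (12 * t ^ 3) \<le> \<theta>0\<^sup>2 / (12 * a ^ 3)"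
      using a by (intro divide_left_mono mult_left_mono power_mono) auto
    also have "\<dots> = 1 / a * (y / 4)"
      using a by (simp add: y_def b_def eval_nat_numeral)
    also have "y / 4 \<le> 1 - 1 / (1 + y / 3)"
      using y by (simp add: field_simps)
    then have "1 / a * (y / 4) \<le> 1 / a * (1 - 1 / (1 + y / 3))"
      using a by (intro mult_left_mono) auto
    also have "\<dots> = 1 / a - 1 / (a * (1 + y / 3))"
      by (simp add: right_diff_distrib)
    also have "\<dots> \<le> 1 / a - 1 / norm (1 - rcis r \<theta>)"
    proof -
      have "0 < a * (1 + y / 3)"
        using a y by (intro mult_pos_pos) auto
      then show ?thesis
        using norm_ge unfolding y_def[symmetric] by (intro diff_left_mono frac_le) auto
    qed
    finally have "\<theta>0\<^sup>2 / (32 * t ^ 3) \<le> 1 / 2 * (1 / a - 1 / norm (1 - rcis r \<theta>))"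
      by simp
    also have "\<dots> \<le> r * (1 / a - 1 / norm (1 - rcis r \<theta>))"
    proof (intro mult_right_mono r_ge)
      have "a * 1 \<le> a * (1 + b / a\<^sup>2 / 3)"
        using a b by (intro mult_left_mono) auto
      also note norm_ge
      finally show "0 \<le> 1 / a - 1 / norm (1 - rcis r \<theta>)"
        using a by (auto intro!: frac_le)
    qed
    finally show ?thesis .
  qed
  \<comment> \<open>r^N <= exp (-1/(4 t)) <= 64 t^2 is small against 1 - r, which has order
    t.\<close>
  have tail: "2 * r ^ Suc N / (1 - r) \<le> 1"
  proof -
    define z where "z = 1 / (4 * t)"
    have z: "0 < z"
      using t by (simp add: z_def)
    have "(z / 2)\<^sup>2 \<le> exp (z / 2) ^ 2"
      using exp_ge_add_one_self[of "z / 2"] z by (intro power_mono) linarith+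
    then have "z\<^sup>2 / 4 \<le> exp z"
      by (simp add: power_divide flip: exp_of_nat_mult)
    then have "exp (- z) \<le> 1 / (z\<^sup>2 / 4)"
      using z by (simp add: exp_minus inverse_eq_divide del: divide_divide_eq_right) (intro frac_le, auto)
    also have "\<dots> = 64 * t\<^sup>2"
      using t by (simp add: z_def power2_eq_square)
    finally have "exp (- z) \<le> 64 * t\<^sup>2" .
    have "r ^ Suc N \<le> r ^ N"
      using r by (intro power_decreasing) auto
    also have "\<dots> = exp (- (real N * t))"
      by (simp only: r_def exp_minus_power)
    also have "\<dots> \<le> exp (- z)"
      using N by (simp add: z_def)
    also note \<open>exp (- z) \<le> 64 * t\<^sup>2\<close>
    finally have "2 * r ^ Suc N \<le> 128 * t\<^sup>2"
      by simp
    \<comment> \<open>The value 1/192 is fixed here: 128 t <= 2/3.\<close>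
    also have "\<dots> \<le> (2 / 3) * t"
      using t t' by (simp add: power2_eq_square)
    also have "\<dots> \<le> 1 - r"
      using a by (simp add: a_def)
    finally show ?thesis
      using r by (simp add: pos_divide_le_eq)
  qed
  also have "1 \<le> \<theta>0\<^sup>2 / (64 * t ^ 3)"
    using \<theta>0 t by simp
  finally have "2 * r ^ Suc N / (1 - r) \<le> \<theta>0\<^sup>2 / (64 * t ^ 3)" .
  then have "\<theta>0\<^sup>2 / (64 * t ^ 3) \<le> \<theta>0\<^sup>2 / (32 * t ^ 3) - 2 * r ^ Suc N / (1 - r)"
    by (simp add: field_simps)
  also have "\<dots> \<le> r * (1 / (1 - r) - 1 / norm (1 - rcis r \<theta>)) - 2 * r ^ Suc N / (1 - r)"
    using main by (simp add: a_def)
  also have "\<dots> \<le> (\<Sum>k=1..N. r ^ k * (1 - cos (real k * \<theta>)))"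
    by (rule sum_one_minus_cos_ge[OF r])
  finally show ?thesis
    by (simp only: r_def)
qed

end

text \<open>The mean lies between 1/(3 t^2) and 4/t^2, so the two endpoints bracket N for the
  intermediate value theorem; 16 <= N ensures N t >= 2 at the lower one. Only this bracket for t is
  kept, no asymptotic value.\<close>

lemma saddle_point_exists:
  assumes N: "16 \<le> N"
  obtains t where "1 / (2 * sqrt (real N)) \<le> t" "t \<le> 2 / sqrt (real N)" "gf_mean N (exp (- t)) = real N"
proof -
  let ?s = "sqrt (real N)"
  have s: "4 \<le> ?s" "?s\<^sup>2 = real N"
    using N real_le_rsqrt[of 4 "real N"] by auto
  have "\<exists>t\<ge>1 / (2 * ?s). t \<le> 2 / ?s \<and> gf_mean N (exp (- t)) = real N"
  proof (rule IVT2')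
    show "1 / (2 * ?s) \<le> 2 / ?s"
      using s N by (intro frac_le) auto
    have "gf_mean N (exp (- (2 / ?s))) \<le> 4 / (2 / ?s)\<^sup>2"
      using s N by (intro gf_mean_le) auto
    also have "\<dots> = real N"
      using s(2) N by (simp add: power_divide)
    finally show "gf_mean N (exp (- (2 / ?s))) \<le> real N" .
    have "real N \<le> 1 / (3 * (1 / (2 * ?s))\<^sup>2)"
      using s(2) by (simp add: power_divide power_mult_distrib)
    also have "\<dots> \<le> gf_mean N (exp (- (1 / (2 * ?s))))"
    proof (rule gf_mean_ge)
      show "0 < 1 / (2 * ?s)"
        using N by simp
      have "1 / (2 * ?s) \<le> 1 / (2 * 1)"
        using s N by (intro frac_le) auto
      then show "1 / (2 * ?s) \<le> 1 / 2"
        by simp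
      have "real N * (1 / (2 * ?s)) = real N / ?s / 2"
        by simp
      then show "2 \<le> real N * (1 / (2 * ?s))"
        using s(1) by (simp only: real_div_sqrt[OF of_nat_0_le_iff])
    qed
    finally show "real N \<le> gf_mean N (exp (- (1 / (2 * ?s))))" .
    show "continuous_on {1 / (2 * ?s)..2 / ?s} (\<lambda>t. gf_mean N (exp (- t)))"
      unfolding gf_mean_def
    proof (intro continuous_intros ballI)
      fix k t assume k: "k \<in> {1..N}" and t: "t \<in> {1 / (2 * ?s)..2 / ?s}"
      have "0 < 1 / (2 * ?s)"
        using s N by simp
      moreover have "1 / (2 * ?s) \<le> t"
        using t by simp
      ultimately have "0 < t"
        by (rule less_le_trans)
      then have "exp (- t) ^ k < 1"
        using k by (simp add: power_less_one_iff)
      then show "1 - exp (- t) ^ k \<noteq> 0"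
        by simp
    qed
  qed
  then show ?thesis
    using that by blast
qed

section \<open>Jensen polynomials and Hermite polynomials\<close>

text \<open>A nonreal zero in addition to d distinct real ones would exceed the degree.\<close>

lemma hyperbolic_if_real_roots:
  fixes q :: "real poly"
  assumes "q \<noteq> 0" "degree q \<le> d" and roots: "\<And>i. i < d \<Longrightarrow> poly q (y i) = 0" and inj: "inj_on y {..<d}"
  shows "hyperbolic q"
  unfolding hyperbolic_def
proof (intro allI impI)
  fix z :: complex
  let ?Q = "map_poly complex_of_real q"
  assume z: "poly ?Q z = 0"
  show "z \<in> \<real>"
  proof (rule ccontr)
    assume "z \<notin> \<real>"
    let ?R = "of_real ` y ` {..<d} :: complex set"
    have real: "poly ?Q (of_real x) = of_real (poly q x)" for x
      by (induction q) (auto simp: map_poly_pCons)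
    have deg: "degree ?Q = degree q"
      by (simp add: degree_map_poly)
    have "?Q \<noteq> 0"
      using \<open>q \<noteq> 0\<close> by (simp add: map_poly_eq_0_iff)
    have "z \<notin> ?R"
      using \<open>z \<notin> \<real>\<close> by auto
    moreover have "card ?R = d"
      using inj by (simp add: card_image inj_on_def image_image)
    ultimately have "card (insert z ?R) = Suc d"
      by simp
    moreover have "insert z ?R \<subseteq> {x. poly ?Q x = 0}"
      using z roots by (auto simp: real)
    then have "card (insert z ?R) \<le> card {x. poly ?Q x = 0}"
      by (intro card_mono poly_roots_finite \<open>?Q \<noteq> 0\<close>)
    ultimately have "Suc d \<le> degree ?Q"
      using card_poly_roots_bound[OF \<open>?Q \<noteq> 0\<close>] by linarith
    then show False
      using assms(2) deg by simp
  qed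
qed

lemma partition_count_pos: "0 < partition_count n"
proof -
  have "replicate_mset n 1 \<in> partitions n"
    by (simp add: partitions_def)
  then show ?thesis
    using finite_partitions by (auto simp: partition_count_def card_gt_0_iff)
qed

lemma coeff_jensen_poly: "coeff (jensen_poly d n) j = (if j \<le> d then real (d choose j) * real (partition_count (n + j)) else 0)"
  by (simp add: jensen_poly_def coeff_sum)

lemma jensen_poly_nonzero: "jensen_poly d n \<noteq> 0"
proof
  assume "jensen_poly d n = 0"
  then have "coeff (jensen_poly d n) 0 = 0"
    by simp
  then show False
    using partition_count_pos[of n] by (simp add: coeff_jensen_poly)
qed

lemma degree_jensen_poly_le: "degree (jensen_poly d n) \<le> d"
  by (rule degree_le) (simp add: coeff_jensen_poly)

text \<open>Treated apart because at d = 1 the threshold is too small to force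
  \<open>78 \<le> D\<close> below.\<close>

lemma hyperbolic_jensen_poly_1: "hyperbolic (jensen_poly 1 n)"
proof (rule hyperbolic_if_real_roots[OF jensen_poly_nonzero degree_jensen_poly_le])
  show "poly (jensen_poly 1 n) (- real (partition_count n) / real (partition_count (n + 1))) = 0" for i :: nat
    using partition_count_pos[of "n + 1"] by (simp add: jensen_poly_def poly_monom)
qed (simp add: inj_on_def)

lemma norm_cis_minus_one_le: "norm (cis x - 1) \<le> \<bar>x\<bar>"
  using iexp_approx1[of x 0] by (simp add: cis_conv_exp)

lemma norm_cis_minus_linear_le: "norm (cis x - 1 - \<i> * of_real x) \<le> x\<^sup>2 / 2"
  using iexp_approx1[of x 1] by (simp add: cis_conv_exp eval_nat_numeral diff_diff_eq)

lemma norm_exp_minus_one_le: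
  fixes w :: complex
  assumes "norm w \<le> 1 / 2"
  shows "norm (exp w - 1) \<le> 2 * norm w"
proof -
  have "norm (exp w - 1) \<le> exp (norm w) * norm w"
    using Taylor_exp_field[of w 0] by simp
  also have "\<dots> \<le> 2 * norm w"
    using real_exp_bound_lemma[of "norm w"] assms by (intro mult_right_mono) auto
  finally show ?thesis .
qed

text \<open>The choice of X makes X + q = r \<delta> (s + (e^(i \<delta> y) - 1) / \<delta>), so the
  small factor (r \<delta>)^d leaves the integral exactly; the remaining \<delta> is the Jacobian of
  \<theta> = \<delta> y.\<close>

lemma jensen_poly_eq_scaled_integral:
  fixes s \<delta> t :: real and n d :: nat
  defines "N \<equiv> n + d" and "r \<equiv> exp (- t)"
  assumes t: "0 < t" and \<delta>: "0 < \<delta>"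
  shows "of_real (2 * pi * poly (jensen_poly d n) (- r * (1 - s * \<delta>))) =
      of_real (\<delta> ^ Suc d * r ^ d / r ^ N) * partition_gf N (of_real r) *
      (LBINT y:{-(pi / \<delta>)..pi / \<delta>}. partition_gf N (rcis r (\<delta> * y)) / partition_gf N (of_real r) * cis (- (\<delta> * y * real N)) *
        (of_real s + (cis (\<delta> * y) - 1) / of_real \<delta>) ^ d)"
proof -
  have r: "0 < r" "r < 1"
    using t by (auto simp: r_def)
  have F: "partition_gf N (of_real r) \<noteq> 0"
    unfolding partition_gf_def using one_minus_power_nonzero[of "of_real r"] r by auto
  let ?f = "\<lambda>x. partition_gf N (rcis r x) * (of_real (- r * (1 - s * \<delta>)) + rcis r x) ^ d / rcis r x ^ N"
  let ?g = "\<lambda>y. partition_gf N (rcis r (\<delta> * y)) / partition_gf N (of_real r) * cis (- (\<delta> * y * real N)) *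
        (of_real s + (cis (\<delta> * y) - 1) / of_real \<delta>) ^ d"
  have f: "?f (\<delta> * y) = of_real (\<delta> ^ d * r ^ d / r ^ N) * partition_gf N (of_real r) * ?g y" for y
  proof -
    define z where "z = of_real s + (cis (\<delta> * y) - 1) / of_real \<delta>"
    define P where "P = partition_gf N (rcis r (\<delta> * y))"
    define G where "G = partition_gf N (of_real r)"
    have 1: "of_real (- r * (1 - s * \<delta>)) + rcis r (\<delta> * y) = of_real (r * \<delta>) * z"
      using \<delta> by (simp add: z_def rcis_def field_simps)
    have 2: "rcis r (\<delta> * y) ^ N = of_real (r ^ N) * cis (\<delta> * y * real N)"
      unfolding DeMoivre2 by (simp add: rcis_def mult.commute)
    have 3: "cis (- (\<delta> * y * real N)) = 1 / cis (\<delta> * y * real N)"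
      by (simp only: cis_inverse[symmetric] inverse_eq_divide)
    have "P * (of_real (r * \<delta>) * z) ^ d / (of_real (r ^ N) * cis (\<delta> * y * real N)) =
        of_real (\<delta> ^ d * r ^ d / r ^ N) * G * (P / G * (1 / cis (\<delta> * y * real N)) * z ^ d)"
      using F r by (simp add: power_mult_distrib G_def)
    then show ?thesis
      by (simp only: 1 2 3 z_def[symmetric] P_def[symmetric] G_def[symmetric])
  qed
  have ind: "indicator {-pi..pi} (\<delta> * y) = (indicator {-(pi / \<delta>)..pi / \<delta>} y :: real)" for y
    using \<delta> by (auto simp: indicator_def field_simps)
  have "of_real (2 * pi * poly (jensen_poly d n) (- r * (1 - s * \<delta>))) = (LBINT x:{-pi..pi}. ?f x)"
    unfolding N_def by (rule jensen_poly_eq_integral[OF r, symmetric])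
  also have "\<dots> = \<bar>\<delta>\<bar> *\<^sub>R (\<integral>y. indicator {-pi..pi} (0 + \<delta> * y) *\<^sub>R ?f (0 + \<delta> * y) \<partial>lborel)"
    unfolding set_lebesgue_integral_def using \<delta> by (intro lborel_integral_real_affine) auto
  also have "\<dots> = of_real \<delta> * (\<integral>y. of_real (\<delta> ^ d * r ^ d / r ^ N) * partition_gf N (of_real r) *
      (indicator {-(pi / \<delta>)..pi / \<delta>} y *\<^sub>R ?g y) \<partial>lborel)"
    unfolding add_0 f ind using \<delta> by (simp only: mult_scaleR_right) (simp add: scaleR_conv_of_real)
  also have "\<dots> = of_real \<delta> * (of_real (\<delta> ^ d * r ^ d / r ^ N) * partition_gf N (of_real r) *
      (LBINT y:{-(pi / \<delta>)..pi / \<delta>}. ?g y))"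
    unfolding set_lebesgue_integral_def integral_mult_right_zero by (rule refl)
  finally show ?thesis
    by simp
qed

text \<open>The major arc is \<open>\<bar>y\<bar> \<le> D^2\<close> in units of the standard deviation: the cubic term of the
  exponent is then of order \<open>D^-8 \<bar>y\<bar>^3 \<le> D^-2\<close>, while the minor arc contributes at most
  \<open>D^(25 (d + 1)) exp (- D^4 / 10240)\<close>. The term \<open>D^-6\<close> coming from the cut-off at \<open>D^2\<close> dominates.\<close>

lemma jensen_poly_near_hermite:
  fixes n d :: nat and t D :: real
  defines "N \<equiv> n + d" and "r \<equiv> exp (- t)"
  assumes D: "78 \<le> D" "25 * (real d + 1) \<le> D" "60 * ((real d + 2) * (real d + 3)) ^ (d + 3) \<le> D ^ 6"
    and t: "t = 1 / D ^ 16" and mean: "gf_mean N r = real N" and N: "1 / (4 * t) \<le> real N * t"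
  shows "\<exists>C \<delta>. 0 < C \<and> 0 < \<delta> \<and> (\<forall>s. \<bar>s\<bar> \<le> real d + 1 \<longrightarrow>
     \<bar>C * poly (jensen_poly d n) (- r * (1 - s * \<delta>)) - sqrt (2 * pi) * poly (hermite d) s\<bar> < sqrt (2 * pi) / 2)"
proof -
  define V where "V = gf_variance N r"
  define \<delta> where "\<delta> = 1 / sqrt V"
  define A where "A = pi / \<delta>"
  define T where "T = D\<^sup>2"
  define \<epsilon> where "\<epsilon> = 4800 / D ^ 8"
  \<comment> \<open>10240 = 5 * 64 * 32, from \<open>norm_partition_gf_le\<close>,
    \<open>sum_one_minus_cos_lower_bound\<close> and \<open>gf_variance_le\<close>.\<close>
  define \<eta> where "\<eta> = exp (- (D ^ 4 / 10240))"
  define F where "F = (\<Prod>k=1..N. 1 / (1 - r ^ k))"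
  define E where "E y = partition_gf N (rcis r (\<delta> * y)) / of_real F * cis (- (\<delta> * y * real N))" for y
  define v where "v y = (cis (\<delta> * y) - 1) / of_real \<delta>" for y
  have t_pos: "0 < t"
    using D t by simp
  have r: "0 < r" "r < 1"
    using t_pos by (auto simp: r_def)
  have t_le: "t \<le> 1 / 192"
  proof -
    have "192 \<le> D ^ 2"
      using power_mono[OF D(1), of 2] by simp
    also have "\<dots> \<le> D ^ 16"
      using D by (intro power_increasing) auto
    finally show ?thesis
      using D by (simp add: t frac_le)
  qed
  have V_le: "V \<le> 32 / t ^ 3"
    unfolding V_def r_def by (rule gf_variance_le[OF t_pos])
  have V_ge: "1 / (3 * t ^ 3) \<le> V"
  proof -
    have "2 \<le> 1 / (4 * t)"
      using t_pos t_le by (simp add: field_simps)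
    then show ?thesis
      unfolding V_def r_def using t_pos t_le N by (intro gf_variance_ge) auto
  qed
  have V_pos: "0 < V"
    using V_ge t_pos by (auto intro: less_le_trans[rotated])
  have \<delta>_pos: "0 < \<delta>"
    using V_pos by (simp add: \<delta>_def)
  have \<delta>_sq: "\<delta>\<^sup>2 = 1 / V"
    using V_pos by (simp add: \<delta>_def power_divide)
  have t3: "t ^ 3 = 1 / D ^ 48" and t4: "t ^ 4 = 1 / D ^ 64"
    by (simp_all add: t power_divide flip: power_mult)
  \<comment> \<open>\<delta> has order t^(3/2) = D^-24; 7/4 is a rational bound for sqrt 3.\<close>
  have \<delta>_le: "\<delta> \<le> 7 / 4 / D ^ 24"
  proof (rule power2_le_imp_le)
    have "\<delta>\<^sup>2 \<le> 1 / (1 / (3 * t ^ 3))"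
      unfolding \<delta>_sq using V_ge t_pos by (intro divide_left_mono mult_pos_pos V_pos) auto
    also have "\<dots> = 3 / D ^ 48"
      by (simp add: t3)
    also have "\<dots> \<le> (7 / 4)\<^sup>2 / D ^ 48"
      using D by (intro divide_right_mono) (auto simp: power_divide)
    also have "\<dots> = (7 / 4 / D ^ 24)\<^sup>2"
      by (simp add: power_divide flip: power_mult)
    finally show "\<delta>\<^sup>2 \<le> (7 / 4 / D ^ 24)\<^sup>2" .
  qed (use D in auto)
  have \<delta>_sq_ge: "t ^ 3 / 32 \<le> \<delta>\<^sup>2"
  proof -
    have "1 / (32 / t ^ 3) \<le> 1 / V"
      using V_le V_pos t_pos by (intro divide_left_mono mult_pos_pos) auto
    then show ?thesis
      by (simp add: \<delta>_sq)
  qed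
  have D2: "6084 \<le> D ^ 2"
    using power_mono[OF D(1), of 2] by simp
  have T: "0 < T"
    using D by (simp add: T_def)
  \<comment> \<open>The edge of the major arc lies within angle t of the saddle, as the minor arc
    estimate with \<theta>0 = T \<delta> requires.\<close>
  have T\<delta>: "T * \<delta> \<le> t"
  proof -
    have "T * \<delta> \<le> D ^ 2 * (7 / 4 / D ^ 24)"
      unfolding T_def using \<delta>_le by (intro mult_left_mono) auto
    also have "\<dots> = 7 / 4 / D ^ 22"
      using D by (simp add: field_simps flip: power_add)
    also have "\<dots> \<le> t"
    proof -
      have "7 / 4 \<le> D ^ 6"
        using D self_le_power[of D 6] by simp
      then have "7 / 4 * D ^ 16 \<le> D ^ 6 * D ^ 16"
        using D by (intro mult_right_mono) auto
      then show ?thesis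
        using D by (simp add: t field_simps flip: power_add)
    qed
    finally show ?thesis .
  qed
  have TA: "T \<le> A"
    using T\<delta> t_le pi_gt3 \<delta>_pos by (simp add: A_def pos_le_divide_eq)
  have F_pos: "0 < F"
    unfolding F_def using r by (intro prod_pos) (auto simp: power_less_one_iff)
  have F: "partition_gf N (of_real r) = of_real F"
    by (simp only: F_def partition_gf_of_real)
  have cont_E: "continuous_on {-A..A} E"
    unfolding E_def
    using F_pos continuous_on_compose2[OF continuous_on_partition_gf_rcis[OF r, of UNIV N], of "{-A..A}" "\<lambda>y. \<delta> * y"]
    by (intro continuous_intros) auto
  have cont_v: "continuous_on {-A..A} v"
    unfolding v_def using \<delta>_pos by (intro continuous_intros) auto
  have v1: "norm (v y) \<le> \<bar>y\<bar>" for y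
  proof -
    have "norm (v y) \<le> \<bar>\<delta> * y\<bar> / \<delta>"
      unfolding v_def norm_divide using \<delta>_pos by (simp add: divide_right_mono norm_cis_minus_one_le)
    then show ?thesis
      using \<delta>_pos by (simp add: abs_mult)
  qed
  have v2: "norm (v y - \<i> * of_real y) \<le> \<delta> * y\<^sup>2" for y
  proof -
    have "v y - \<i> * of_real y = (cis (\<delta> * y) - 1 - \<i> * of_real (\<delta> * y)) / of_real \<delta>"
      using \<delta>_pos by (simp add: v_def field_simps)
    then have "norm (v y - \<i> * of_real y) = norm (cis (\<delta> * y) - 1 - \<i> * of_real (\<delta> * y)) / \<delta>"
      using \<delta>_pos by (simp only: norm_divide norm_of_real abs_of_pos)
    also have "\<dots> \<le> (\<delta> * y)\<^sup>2 / 2 / \<delta>"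
      using \<delta>_pos by (intro divide_right_mono norm_cis_minus_linear_le) auto
    also have "\<dots> = \<delta> * y\<^sup>2 / 2"
      using \<delta>_pos by (simp add: power2_eq_square)
    also have "\<dots> \<le> \<delta> * y\<^sup>2"
      using \<delta>_pos by simp
    finally show ?thesis .
  qed
  have major: "norm (E y - of_real (exp (- y\<^sup>2 / 2))) \<le> \<epsilon> * \<bar>y\<bar> ^ 3 * exp (- y\<^sup>2 / 2)" if y: "\<bar>y\<bar> \<le> T" for y
  proof -
    obtain w where w: "partition_gf N (rcis r (\<delta> * y)) = partition_gf N (of_real r) *
      exp (\<i> * of_real (\<delta> * y * gf_mean N r) - of_real ((\<delta> * y)\<^sup>2 * gf_variance N r / 2) + w)"
      and norm_w: "norm w \<le> \<bar>\<delta> * y\<bar> ^ 3 * gf_third N r / 2"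
      using partition_gf_expansion[OF r] by blast
    have "(\<delta> * y)\<^sup>2 * gf_variance N r / 2 = y\<^sup>2 / 2"
      using V_pos by (simp add: power_mult_distrib \<delta>_sq V_def)
    \<comment> \<open>The saddle point equation cancels the linear phase, and \<delta>^2 V = 1
      normalises the quadratic term.\<close>
    then have "E y = exp (\<i> * of_real (\<delta> * y * real N) - of_real (y\<^sup>2 / 2) + w) * exp (- (\<i> * of_real (\<delta> * y * real N)))"
      using F_pos by (simp add: E_def w F mean cis_conv_exp)
    also have "\<dots> = of_real (exp (- y\<^sup>2 / 2)) * exp w"
      by (simp add: exp_of_real[symmetric] flip: exp_add)
    finally have "E y - of_real (exp (- y\<^sup>2 / 2)) = of_real (exp (- y\<^sup>2 / 2)) * (exp w - 1)"
      by (simp add: algebra_simps)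
    then have E: "norm (E y - of_real (exp (- y\<^sup>2 / 2))) = exp (- y\<^sup>2 / 2) * norm (exp w - 1)"
      by (simp add: norm_mult)
    \<comment> \<open>\<delta>^3 / t^4 has order D^-8; the constant (7/4)^3 * 864 / 2 = 2315.25 is
      rounded up to 2400.\<close>
    have "\<bar>\<delta> * y\<bar> ^ 3 * gf_third N r / 2 \<le> (7 / 4 / D ^ 24 * \<bar>y\<bar>) ^ 3 * (864 / t ^ 4) / 2"
    proof (intro divide_right_mono mult_mono power_mono)
      show "\<bar>\<delta> * y\<bar> \<le> 7 / 4 / D ^ 24 * \<bar>y\<bar>"
        using \<delta>_le \<delta>_pos by (simp only: abs_mult abs_of_pos) (intro mult_right_mono, auto)
      show "gf_third N r \<le> 864 / t ^ 4"
        unfolding r_def by (rule gf_third_le[OF t_pos])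
      show "0 \<le> gf_third N r"
        unfolding gf_third_def using r
        by (intro sum_nonneg mult_nonneg_nonneg divide_nonneg_nonneg) (auto simp: power_le_one)
    qed auto
    also have "\<dots> = (343 / 64 * 432) * (D ^ 64 / D ^ 72) * \<bar>y\<bar> ^ 3"
      by (simp add: t4 power_divide power_mult_distrib flip: power_mult)
    also have "D ^ 64 / D ^ 72 = 1 / D ^ 8"
      using D by (simp add: field_simps flip: power_add)
    also have "343 / 64 * 432 * (1 / D ^ 8) * \<bar>y\<bar> ^ 3 \<le> 2400 * (1 / D ^ 8) * \<bar>y\<bar> ^ 3"
      using D by (intro mult_right_mono) auto
    finally have w2: "norm w \<le> 2400 * (1 / D ^ 8) * \<bar>y\<bar> ^ 3"
      using norm_w by linarith
    also have "\<dots> \<le> 2400 * (1 / D ^ 8) * T ^ 3"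
      using y D by (intro mult_left_mono power_mono) auto
    also have "\<dots> = 2400 * (D ^ 6 / D ^ 8)"
      by (simp add: T_def flip: power_mult)
    also have "D ^ 6 / D ^ 8 = 1 / D ^ 2"
      using D by (simp add: field_simps flip: power_add)
    also have "2400 * (1 / D ^ 2) \<le> 2400 * (1 / 6084)"
      using D2 by (intro mult_left_mono frac_le) auto
    finally have "norm w \<le> 1 / 2"
      by simp
    then have "norm (exp w - 1) \<le> 2 * norm w"
      by (rule norm_exp_minus_one_le)
    also have "\<dots> \<le> \<epsilon> * \<bar>y\<bar> ^ 3"
      using w2 by (simp add: \<epsilon>_def)
    finally show ?thesis
      unfolding E by (simp add: mult.commute mult_left_mono)
  qed
  have minor: "norm (E y) \<le> \<eta>" if y: "T \<le> \<bar>y\<bar>" "\<bar>y\<bar> \<le> A" for y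
  proof -
    \<comment> \<open>2048 = 64 * 32 turns (T \<delta>)^2 >= D^4 t^3 / 32 into the condition 64 t^3
      <= \<theta>0^2.\<close>
    have D4: "D ^ 4 \<ge> 2048"
      using power_mono[OF D(1), of 4] by simp
    have T\<delta>_sq: "D ^ 4 * (t ^ 3 / 32) \<le> (T * \<delta>)\<^sup>2"
      using \<delta>_sq_ge D by (simp add: T_def power_mult_distrib mult_left_mono flip: power_mult)
    have "2048 * (t ^ 3 / 32) \<le> D ^ 4 * (t ^ 3 / 32)"
      using D4 t_pos by (intro mult_right_mono) auto
    then have "(T * \<delta>)\<^sup>2 / (64 * t ^ 3) \<le> (\<Sum>k=1..N. exp (- t) ^ k * (1 - cos (real k * (\<delta> * y))))"
    proof (intro sum_one_minus_cos_lower_bound t_pos t_le N T\<delta>)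
      show "0 < T * \<delta>"
        using T \<delta>_pos by simp
      show "T * \<delta> \<le> \<bar>\<delta> * y\<bar>"
        using y \<delta>_pos by (simp add: abs_mult mult.commute)
      show "\<bar>\<delta> * y\<bar> \<le> pi"
        using y(2) \<delta>_pos by (simp add: abs_mult A_def pos_le_divide_eq mult.commute)
    qed (use T\<delta>_sq in auto)
    moreover have "D ^ 4 / 2048 \<le> (T * \<delta>)\<^sup>2 / (64 * t ^ 3)"
      using T\<delta>_sq t_pos by (simp add: field_simps)
    ultimately have S: "D ^ 4 / 2048 \<le> (\<Sum>k=1..N. r ^ k * (1 - cos (real k * (\<delta> * y))))"
      by (simp only: r_def)
    have "norm (E y) = norm (partition_gf N (rcis r (\<delta> * y))) / F"
      using F_pos by (simp add: E_def norm_mult norm_divide)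
    also have "\<dots> \<le> F * exp (- ((\<Sum>k=1..N. r ^ k * (1 - cos (real k * (\<delta> * y)))) / 5)) / F"
      using norm_partition_gf_le[OF r, of N "\<delta> * y"] F_pos by (intro divide_right_mono) (auto simp: F)
    also have "\<dots> = exp (- ((\<Sum>k=1..N. r ^ k * (1 - cos (real k * (\<delta> * y)))) / 5))"
      using F_pos by simp
    also have "\<dots> \<le> \<eta>"
      using S by (simp add: \<eta>_def)
    finally show ?thesis .
  qed
  have bound: "(\<epsilon> + real d * \<delta> + 1 / T ^ 3) * ((1 + \<bar>s\<bar>) ^ (d + 3) * (real (d + 3) ^ (d + 3) * exp 2)) * (2 * sqrt pi)
      + 2 * A * (\<eta> * (\<bar>s\<bar> + A) ^ d) < sqrt (2 * pi) / 2" if s: "\<bar>s\<bar> \<le> real d + 1" for s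
  proof -
    \<comment> \<open>Error budget: the first summand stays below 148/600 * 18/5 = 0.888 and the
      minor arc below 1/8, against sqrt (2 pi) / 2 >= 5/4. The constant 60 in the hypothesis on D^6
      is fitted to this.\<close>
    have "\<epsilon> + real d * \<delta> + 1 / T ^ 3 \<le> 2 / D ^ 6"
    proof -
      have "\<epsilon> = 4800 / D\<^sup>2 * (1 / D ^ 6)"
        by (simp add: \<epsilon>_def flip: power_add)
      \<comment> \<open>The value 78 matters here: 78^2 = 6084 exceeds 4800 / 0.8 = 6000.\<close>
      also have "\<dots> \<le> 8 / 10 * (1 / D ^ 6)"
        using D2 D by (intro mult_right_mono) (auto simp: field_simps)
      finally have 1: "\<epsilon> \<le> 8 / 10 * (1 / D ^ 6)" .
      have "real d * \<delta> \<le> D * (7 / 4 / D ^ 24)"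
        using \<delta>_le \<delta>_pos D by (intro mult_mono) auto
      also have "\<dots> = 7 / 4 / D ^ 17 * (1 / D ^ 6)"
        using D by (simp add: field_simps flip: power_add power_Suc)
      also have "\<dots> \<le> 2 / 10 * (1 / D ^ 6)"
      proof (intro mult_right_mono)
        have "D \<le> D ^ 17"
          using D by (intro self_le_power) auto
        then show "7 / 4 / D ^ 17 \<le> 2 / 10"
          using D by (simp add: field_simps)
      qed (use D in auto)
      finally have 2: "real d * \<delta> \<le> 2 / 10 * (1 / D ^ 6)" .
      have "1 / T ^ 3 = 1 / D ^ 6"
        by (simp add: T_def flip: power_mult)
      with 1 2 show ?thesis
        by simp
    qed
    moreover have "(1 + \<bar>s\<bar>) ^ (d + 3) * (real (d + 3) ^ (d + 3) * exp 2) \<le> D ^ 6 / 60 * (74 / 10)"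
    proof -
      have "exp 2 = exp 1 * exp (1::real)"
        by (simp flip: exp_add)
      also have "\<dots> \<le> (272 / 100) * (272 / 100)"
        using e_less_272 by (intro mult_mono) auto
      finally have e: "exp 2 \<le> (74 / 10 :: real)"
        by simp
      have "(1 + \<bar>s\<bar>) ^ (d + 3) * real (d + 3) ^ (d + 3) \<le> (real d + 2) ^ (d + 3) * real (d + 3) ^ (d + 3)"
        using s by (intro mult_right_mono power_mono) auto
      also have "\<dots> = ((real d + 2) * (real d + 3)) ^ (d + 3)"
        by (simp add: power_mult_distrib)
      also have "\<dots> \<le> D ^ 6 / 60"
        using D(3) by simp
      finally have "(1 + \<bar>s\<bar>) ^ (d + 3) * real (d + 3) ^ (d + 3) * exp 2 \<le> D ^ 6 / 60 * (74 / 10)"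
        using e D by (intro mult_mono) auto
      then show ?thesis
        by (simp only: mult.assoc)
    qed
    ultimately have "(\<epsilon> + real d * \<delta> + 1 / T ^ 3) * ((1 + \<bar>s\<bar>) ^ (d + 3) * (real (d + 3) ^ (d + 3) * exp 2))
        \<le> 2 / D ^ 6 * (D ^ 6 / 60 * (74 / 10))"
      by (rule mult_mono) (use D in auto)
    also have "\<dots> = 148 / 600"
      using D by simp
    finally have "(\<epsilon> + real d * \<delta> + 1 / T ^ 3) * ((1 + \<bar>s\<bar>) ^ (d + 3) * (real (d + 3) ^ (d + 3) * exp 2)) * (2 * sqrt pi)
        \<le> 148 / 600 * (2 * (18 / 10))"
    proof (rule mult_mono)
      have "sqrt pi \<le> 18 / 10"
        using pi_approx by (intro real_le_lsqrt) (auto simp: power2_eq_square)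
      then show "2 * sqrt pi \<le> 2 * (18 / 10)"
        by simp
    qed auto
    \<comment> \<open>A has order D^24, so the polynomial factors are at most D^(25 (d + 1)). As D
      <= exp (D/2) and 25 (d + 1) <= D, this is at most exp (D^2/2), which loses against exp (-
      D^4/10240) once D^2 >= 6084.\<close>
    moreover have "2 * A * (\<eta> * (\<bar>s\<bar> + A) ^ d) \<le> 1 / 8"
    proof -
      \<comment> \<open>17/3 is a rational bound for sqrt 32.\<close>
      have "V \<le> (17 / 3 * D ^ 24)\<^sup>2"
      proof -
        have "V \<le> 32 * D ^ 48"
          using V_le by (simp add: t3)
        also have "\<dots> \<le> (17 / 3)\<^sup>2 * D ^ 48"
          using D by (intro mult_right_mono) (auto simp: power2_eq_square)
        also have "\<dots> = (17 / 3 * D ^ 24)\<^sup>2"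
          by (simp add: power_mult_distrib power_divide flip: power_mult)
        finally show ?thesis .
      qed
      then have "sqrt V \<le> 17 / 3 * D ^ 24"
        using D by (intro real_le_lsqrt) auto
      then have "A \<le> pi * (17 / 3 * D ^ 24)"
        by (simp add: A_def \<delta>_def)
      also have "\<dots> \<le> 315 / 100 * (17 / 3 * D ^ 24)"
        using pi_approx D by (intro mult_right_mono) auto
      also have "\<dots> \<le> 18 * D ^ 24"
        using D by simp
      finally have A: "A \<le> 18 * D ^ 24" .
      have D25: "78 * D ^ 24 \<le> D ^ 25"
        using D mult_right_mono[of 78 D "D ^ 24"] by (simp flip: power_Suc)
      have "D \<le> D ^ 24"
        using D by (intro self_le_power) auto
      moreover have "real d + 1 \<le> D" "0 \<le> D"
        using D(1,2) by auto
      ultimately have "\<bar>s\<bar> + A \<le> 78 * D ^ 24" "2 * A \<le> 78 * D ^ 24"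
        using A s by auto
      then have sA: "\<bar>s\<bar> + A \<le> D ^ 25" and A2: "2 * A \<le> D ^ 25"
        using D25 by (blast intro: order_trans)+
      have A_pos: "0 < A"
        using T TA by linarith
      have "2 * A * (\<eta> * (\<bar>s\<bar> + A) ^ d) \<le> D ^ 25 * (\<eta> * (D ^ 25) ^ d)"
        using A2 sA A_pos D(1) by (intro mult_mono power_mono) (auto simp: \<eta>_def)
      also have "\<dots> = D ^ (25 * Suc d) * \<eta>"
        by (simp add: power_add mult_ac flip: power_mult)
      also have "D ^ (25 * Suc d) \<le> exp (D / 2) ^ (25 * Suc d)"
      proof (rule power_mono)
        have "D \<le> (1 + D / 4)\<^sup>2"
          using zero_le_power2[of "1 - D / 4"] by (simp add: power2_eq_square algebra_simps)
        also have "\<dots> \<le> (exp (D / 4))\<^sup>2"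
          using exp_ge_add_one_self[of "D / 4"] D by (intro power_mono) auto
        also have "\<dots> = exp (D / 2)"
          by (simp flip: exp_of_nat_mult)
        finally show "D \<le> exp (D / 2)" .
      qed (use D in auto)
      also have "\<dots> = exp (real (25 * Suc d) * (D / 2))"
        by (rule exp_of_nat_mult[symmetric])
      also have "\<dots> \<le> exp (D * (D / 2))"
      proof -
        have "real (25 * Suc d) \<le> D"
          using D(2) by simp
        then have "real (25 * Suc d) * (D / 2) \<le> D * (D / 2)"
          using D(1) by (intro mult_right_mono) auto
        then show ?thesis
          by (simp only: exp_le_cancel_iff)
      qed
      finally have "2 * A * (\<eta> * (\<bar>s\<bar> + A) ^ d) \<le> exp (D * (D / 2)) * \<eta>"
        by (simp add: \<eta>_def)
      also have "\<dots> = exp (D\<^sup>2 / 2 - D ^ 4 / 10240)"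
        by (simp add: \<eta>_def power2_eq_square flip: exp_add)
      also have "\<dots> \<le> exp (- 7)"
      proof -
        have "6084 * D\<^sup>2 \<le> D\<^sup>2 * D\<^sup>2"
          using D2 by (intro mult_right_mono) auto
        then have "6084 * D\<^sup>2 \<le> D ^ 4"
          by (simp flip: power_add)
        then show ?thesis
          using D2 by simp
      qed
      also have "\<dots> \<le> 1 / 8"
        using exp_ge_add_one_self[of "7::real"] by (simp add: exp_minus inverse_eq_divide frac_le)
      finally show ?thesis .
    qed
    moreover have "5 / 2 \<le> sqrt (2 * pi)"
      using pi_approx by (intro real_le_rsqrt) (auto simp: power2_eq_square)
    ultimately show ?thesis
      by linarith
  qed
  define c where "c = \<delta> ^ Suc d * r ^ d / r ^ N * F"
  define C where "C = 2 * pi / c"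
  have c: "0 < c"
    unfolding c_def using \<delta>_pos r F_pos by (intro mult_pos_pos divide_pos_pos zero_less_power)
  have "\<bar>C * poly (jensen_poly d n) (- r * (1 - s * \<delta>)) - sqrt (2 * pi) * poly (hermite d) s\<bar> < sqrt (2 * pi) / 2"
    if s: "\<bar>s\<bar> \<le> real d + 1" for s
  proof -
    let ?J = "poly (jensen_poly d n) (- r * (1 - s * \<delta>))"
    have "of_real (2 * pi * ?J) = of_real c * (LBINT y:{-A..A}. E y * (of_real s + v y) ^ d)"
      using jensen_poly_eq_scaled_integral[OF t_pos \<delta>_pos, of d n s]
      unfolding r_def[symmetric] N_def[symmetric] F A_def E_def v_def c_def of_real_mult[symmetric] .
    then have "(LBINT y:{-A..A}. E y * (of_real s + v y) ^ d) = of_real (C * ?J)"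
      using c by (simp add: C_def field_simps)
    moreover have "norm ((LBINT y:{-A..A}. E y * (of_real s + v y) ^ d) - of_real (sqrt (2 * pi) * poly (hermite d) s))
      < sqrt (2 * pi) / 2"
      by (rule le_less_trans[OF gauss_comparison[OF cont_E cont_v T TA _ _ _ major minor v1 v2] bound[OF s]])
         (use \<delta>_pos D in \<open>auto simp: \<epsilon>_def \<eta>_def\<close>)
    ultimately show ?thesis
      by (simp only: of_real_diff[symmetric] norm_of_real)
  qed
  moreover have "0 < C"
    using c by (simp add: C_def)
  ultimately show ?thesis
    using \<delta>_pos by blast
qed

section \<open>The threshold\<close>

text \<open>The exponents are frozen at their values for d = 2; the resulting degree 60 in d is
  enough for the two conditions of degree at most 32.\<close>

lemma threshold_ge:
  fixes d :: nat
  assumes d: "2 \<le> d"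
  shows "(3 * d) ^ 48 * (50 * d) ^ 12 \<le> (3 * d) ^ (24 * d) * (50 * d) ^ (3 * d\<^sup>2)"
proof (intro mult_mono power_increasing)
  have "2 * 2 \<le> d * d"
    using d by (intro mult_mono) auto
  then show "12 \<le> 3 * d\<^sup>2"
    by (simp add: power2_eq_square)
qed (use d in auto)

text \<open>This and the next two lemmas are the three size conditions on D in
  \<open>jensen_poly_near_hermite\<close>, transported through B <= 4 D^32 with B the
  threshold.\<close>

lemma threshold_ge_78:
  fixes d :: nat
  assumes d: "2 \<le> d"
  shows "4 * 78 ^ 32 \<le> (3 * d) ^ (24 * d) * (50 * d) ^ (3 * d\<^sup>2)"
proof -
  have "4 * 78 ^ 32 \<le> (3 * 2) ^ 48 * (50 * 2 :: nat) ^ 12"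
    by simp
  also have "\<dots> \<le> (3 * d) ^ 48 * (50 * d) ^ 12"
    using d by (intro mult_mono power_mono) auto
  also note threshold_ge[OF d]
  finally show ?thesis .
qed

lemma threshold_ge_degree:
  fixes d :: nat
  assumes d: "2 \<le> d"
  shows "4 * (25 * (d + 1)) ^ 32 \<le> (3 * d) ^ (24 * d) * (50 * d) ^ (3 * d\<^sup>2)"
proof -
  \<comment> \<open>The extra 2^32 avoids fractions in 25 (d + 1) <= 75 d / 2.\<close>
  have "2 ^ 32 * (4 * (25 * (d + 1)) ^ 32) = 4 * (2 * (25 * (d + 1))) ^ 32"
    by (simp only: power_mult_distrib mult.left_commute)
  also have "\<dots> \<le> 4 * (75 * d) ^ 32"
    using d by (intro mult_left_mono power_mono) auto
  also have "\<dots> = 4 * 75 ^ 32 * d ^ 32"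
    by (simp add: power_mult_distrib)
  also have "\<dots> \<le> 2 ^ 32 * (3 ^ 48 * 50 ^ 12) * 2 ^ 28 * d ^ 32"
    by (intro mult_right_mono) simp_all
  \<comment> \<open>Of the 60 available powers of d, the 28 beyond d^32 supply the constant
    2^28.\<close>
  also have "\<dots> \<le> 2 ^ 32 * (3 ^ 48 * 50 ^ 12) * d ^ 28 * d ^ 32"
    using d by (intro mult_right_mono mult_left_mono power_mono) auto
  also have "\<dots> = 2 ^ 32 * ((3 * d) ^ 48 * (50 * d) ^ 12)"
  proof -
    have "d ^ 28 * d ^ 32 = d ^ 48 * d ^ 12"
      by (simp flip: power_add)
    then show ?thesis
      by (simp only: power_mult_distrib mult.assoc mult.left_commute[of "d ^ 48"])
  qed
  also have "\<dots> \<le> 2 ^ 32 * ((3 * d) ^ (24 * d) * (50 * d) ^ (3 * d\<^sup>2))"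
    by (intro mult_left_mono threshold_ge d) simp
  finally show ?thesis
    by (rule mult_left_le_imp_le) simp
qed

text \<open>D^6 and D^32 meet at D^96: the 16th power of the condition on D^6 is compared with the
  cube of the threshold. As 16 (d + 3) <= 40 d, both sides reduce to d-th powers, with bases of
  degree 80 and 90 in d.\<close>

lemma threshold_ge_power:
  fixes d :: nat
  assumes d: "2 \<le> d"
  shows "4 ^ 3 * (60 * ((d + 2) * (d + 3)) ^ (d + 3)) ^ 16 \<le> ((3 * d) ^ (24 * d) * (50 * d) ^ (3 * d\<^sup>2)) ^ 3"
proof -
  have X: "(d + 2) * (d + 3) \<le> 5 * d\<^sup>2"
  proof -
    have "2 * ((d + 2) * (d + 3)) = (d + 2) * (2 * (d + 3))"
      by simp
    also have "\<dots> \<le> (2 * d) * (5 * d)"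
      by (rule mult_mono) (use d in auto)
    finally show ?thesis
      by (simp add: power2_eq_square)
  qed
  have "4 ^ 3 * (60 * ((d + 2) * (d + 3)) ^ (d + 3)) ^ 16 = 4 ^ 3 * 60 ^ 16 * ((d + 2) * (d + 3)) ^ (16 * (d + 3))"
    by (simp only: power_mult_distrib power_mult[symmetric] mult.commute[of 16] mult.assoc)
  also have "\<dots> \<le> (10 ^ 16) ^ 2 * ((d + 2) * (d + 3)) ^ (16 * (d + 3))"
    by (intro mult_right_mono) simp_all
  also have "\<dots> \<le> (10 ^ 16) ^ d * (5 * d\<^sup>2) ^ (40 * d)"
  proof (intro mult_mono power_increasing)
    have "((d + 2) * (d + 3)) ^ (16 * (d + 3)) \<le> (5 * d\<^sup>2) ^ (16 * (d + 3))"
      by (intro power_mono X) simp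
    also have "\<dots> \<le> (5 * d\<^sup>2) ^ (40 * d)"
      using d by (intro power_increasing) auto
    finally show "((d + 2) * (d + 3)) ^ (16 * (d + 3)) \<le> (5 * d\<^sup>2) ^ (40 * d)" .
  qed (use d in auto)
  also have "\<dots> = (10 ^ 16 * 5 ^ 40 * d ^ 80) ^ d"
    by (simp only: power_mult power_mult_distrib) (simp flip: power_mult)
  also have "\<dots> \<le> (3 ^ 72 * 50 ^ 18 * d ^ 90) ^ d"
    using d by (intro power_mono mult_mono power_increasing) auto
  also have "\<dots> = ((3 * d) ^ 72 * (50 * d) ^ 18) ^ d"
  proof -
    have "d ^ 90 = d ^ 72 * d ^ 18"
      by (simp flip: power_add)
    then show ?thesis
      by (simp only: power_mult_distrib mult.assoc mult.left_commute[of "d ^ 72"])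
  qed
  also have "\<dots> = (3 * d) ^ (72 * d) * (50 * d) ^ (18 * d)"
    by (simp only: power_mult_distrib power_mult)
  also have "\<dots> \<le> (3 * d) ^ (72 * d) * (50 * d) ^ (9 * d\<^sup>2)"
    using d by (intro mult_left_mono power_increasing) (auto simp: power2_eq_square)
  also have "\<dots> = ((3 * d) ^ (24 * d) * (50 * d) ^ (3 * d\<^sup>2)) ^ 3"
    by (simp only: power_mult_distrib power_mult[symmetric]) (simp add: mult.commute)
  finally show ?thesis .
qed

lemma hyperbolic_jensen_poly:
  fixes d n :: nat
  assumes d: "2 \<le> d" and n: "(3 * d) ^ (24 * d) * (50 * d) ^ (3 * d\<^sup>2) \<le> n"
  shows "hyperbolic (jensen_poly d n)"
proof -
  define B where "B = (3 * d) ^ (24 * d) * (50 * d) ^ (3 * d\<^sup>2)"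
  define N where "N = n + d"
  have B: "4 * 78 ^ 32 \<le> B" "4 * (25 * (d + 1)) ^ 32 \<le> B" "4 ^ 3 * (60 * ((d + 2) * (d + 3)) ^ (d + 3)) ^ 16 \<le> B ^ 3"
    unfolding B_def using threshold_ge_78[OF d] threshold_ge_degree[OF d] threshold_ge_power[OF d] .
  have BN: "B \<le> N"
    using n by (simp add: B_def N_def)
  then have N: "16 \<le> N"
    using B(1) by simp
  obtain t where t: "1 / (2 * sqrt (real N)) \<le> t" "t \<le> 2 / sqrt (real N)" "gf_mean N (exp (- t)) = real N"
    using saddle_point_exists[OF N] .
  have N_pos: "0 < sqrt (real N)"
    using N by simp
  have t_pos: "0 < t"
    using t(1) N_pos by (auto intro: less_le_trans[rotated])
  \<comment> \<open>With exponent 16 both the cut-off t^(-1/8) and the scale t^(3/2) of \<delta> are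
    integral powers of D.\<close>
  define D where "D = root 16 (1 / t)"
  have D_pos: "0 < D"
    using t_pos by (simp add: D_def)
  have D16: "D ^ 16 = 1 / t"
    using t_pos by (simp add: D_def)
  \<comment> \<open>The factor 4 comes from the upper end 2 / sqrt N of the saddle point
    bracket.\<close>
  have D32: "real B \<le> 4 * D ^ 32"
  proof -
    have "t\<^sup>2 \<le> (2 / sqrt (real N))\<^sup>2"
      using t(2) t_pos by (intro power_mono) auto
    also have "\<dots> = 4 / real N"
      by (simp add: power_divide)
    finally have "t\<^sup>2 * real N \<le> 4"
      using N by (simp add: pos_le_divide_eq)
    then have "real N \<le> 4 * (1 / t)\<^sup>2"
      using t_pos by (simp add: power_divide field_simps)
    also have "(1 / t)\<^sup>2 = D ^ 32"
      by (simp add: D16[symmetric] flip: power_mult)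
    finally show ?thesis
      using BN by simp
  qed
  have ge: "x \<le> D" if "4 * x ^ 32 \<le> real B" for x :: real
  proof (rule power_le_imp_le_base)
    show "x ^ Suc 31 \<le> D ^ Suc 31"
      using that D32 by simp
  qed (use D_pos in simp)
  have D1: "78 \<le> D"
  proof (rule ge)
    have "real (4 * 78 ^ 32) \<le> real B"
      using B(1) by (simp only: of_nat_le_iff)
    then show "4 * 78 ^ 32 \<le> real B"
      by simp
  qed
  have D2: "25 * (real d + 1) \<le> D"
  proof (rule ge)
    have "real (4 * (25 * (d + 1)) ^ 32) \<le> real B"
      using B(2) by (simp only: of_nat_le_iff)
    then show "4 * (25 * (real d + 1)) ^ 32 \<le> real B"
      by (simp only: of_nat_mult of_nat_power of_nat_add of_nat_numeral of_nat_1)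
  qed
  have D3: "60 * ((real d + 2) * (real d + 3)) ^ (d + 3) \<le> D ^ 6"
  proof (rule power_le_imp_le_base)
    let ?Y = "60 * ((real d + 2) * (real d + 3)) ^ (d + 3)"
    have "real (4 ^ 3 * (60 * ((d + 2) * (d + 3)) ^ (d + 3)) ^ 16) \<le> real (B ^ 3)"
      using B(3) by (simp only: of_nat_le_iff)
    then have "4 ^ 3 * ?Y ^ 16 \<le> real B ^ 3"
      by (simp only: of_nat_mult of_nat_power of_nat_add of_nat_numeral)
    also have "\<dots> \<le> (4 * D ^ 32) ^ 3"
      by (intro power_mono D32) simp
    also have "\<dots> = 4 ^ 3 * (D ^ 6) ^ 16"
      by (simp only: power_mult_distrib power_mult[symmetric]) simp
    finally show "?Y ^ Suc 15 \<le> (D ^ 6) ^ Suc 15"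
      by simp
  qed simp
  have Nt: "1 / (4 * t) \<le> real N * t"
  proof -
    have "(1 / (2 * sqrt (real N)))\<^sup>2 \<le> t\<^sup>2"
      using t(1) by (intro power_mono) auto
    then have "1 / (4 * real N) \<le> t\<^sup>2"
      by (simp add: power_divide power_mult_distrib)
    then have "1 \<le> t\<^sup>2 * (4 * real N)"
      using N by (simp add: pos_divide_le_eq)
    then show ?thesis
      using t_pos by (simp add: pos_divide_le_eq power2_eq_square mult_ac)
  qed
  define r where "r = exp (- t)"
  obtain C \<delta> where C: "0 < C" and \<delta>: "0 < \<delta>" and near: "\<And>s. \<bar>s\<bar> \<le> real d + 1 \<Longrightarrow>
     \<bar>C * poly (jensen_poly d n) (- r * (1 - s * \<delta>)) - sqrt (2 * pi) * poly (hermite d) s\<bar> < sqrt (2 * pi) / 2"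
    using jensen_poly_near_hermite[OF D1 D2 D3, of t n] t(3) Nt t_pos D16 unfolding N_def r_def by auto
  obtain x where x_mono: "\<And>i j. i < j \<Longrightarrow> j \<le> d \<Longrightarrow> x i < x j"
    and x_bound: "\<And>i. i \<le> d \<Longrightarrow> \<bar>x i\<bar> \<le> real (Suc d)"
    and x_sign: "\<And>i. i \<le> d \<Longrightarrow> 1 / 2 \<le> (- 1) ^ (d - i) * poly (hermite d) (x i)"
    using hermite_alternation[of d] by blast
  define a where "a i = - r * (1 - x i * \<delta>)" for i
  have sign: "0 < (- 1) ^ (d - i) * poly (jensen_poly d n) (a i)" if i: "i \<le> d" for i
  proof -
    define \<sigma> :: real where "\<sigma> = (- 1) ^ (d - i)"
    have \<sigma>: "\<sigma> = 1 \<or> \<sigma> = - 1"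
      by (auto simp: \<sigma>_def minus_one_power_iff)
    \<comment> \<open>The Hermite side has signed size at least c/2 and the error is strictly below
      c/2, so the sign survives.\<close>
    have aux: "0 < \<sigma> * u" if "c / 2 \<le> \<sigma> * h" "\<bar>u - h\<bar> < c / 2" for u h c :: real
    proof -
      have "- (c / 2) < u - h" "u - h < c / 2"
        using that(2) by (simp_all only: abs_less_iff) linarith
      then have "h - c / 2 < u" "u < h + c / 2"
        by (simp_all only: less_diff_eq diff_less_eq)
      with \<sigma> show ?thesis
        using that(1) by (cases "\<sigma> = 1") simp_all
    qed
    have "sqrt (2 * pi) * (1 / 2) \<le> sqrt (2 * pi) * (\<sigma> * poly (hermite d) (x i))"
      unfolding \<sigma>_def by (intro mult_left_mono x_sign i) auto
    then have "sqrt (2 * pi) / 2 \<le> \<sigma> * (sqrt (2 * pi) * poly (hermite d) (x i))"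
      by (simp add: mult.left_commute[of \<sigma>])
    moreover have "\<bar>C * poly (jensen_poly d n) (a i) - sqrt (2 * pi) * poly (hermite d) (x i)\<bar> < sqrt (2 * pi) / 2"
      unfolding a_def using x_bound[OF i] by (intro near) simp
    ultimately have "0 < \<sigma> * (C * poly (jensen_poly d n) (a i))"
      by (rule aux)
    then have "0 < C * (\<sigma> * poly (jensen_poly d n) (a i))"
      by (simp only: mult.left_commute)
    then show ?thesis
      unfolding \<sigma>_def using C by (rule zero_less_mult_pos)
  qed
  have "\<exists>y. (\<forall>i<d. a i < y i \<and> y i < a (Suc i) \<and> poly (jensen_poly d n) (y i) = 0) \<and>
     (\<forall>i j. i < j \<longrightarrow> j < d \<longrightarrow> y i < y j)"
  proof (rule alternating_poly_roots)
    fix i assume i: "i < d"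
    have "r * (x i * \<delta>) < r * (x (Suc i) * \<delta>)"
      using x_mono[of i "Suc i"] i \<delta> by (simp add: r_def)
    then show "a i < a (Suc i)"
      by (simp add: a_def algebra_simps)
    have "0 < ((- 1) ^ (d - i) * poly (jensen_poly d n) (a i)) *
       ((- 1) ^ (d - Suc i) * poly (jensen_poly d n) (a (Suc i)))"
      using i by (intro mult_pos_pos sign) auto
    also have "(- 1) ^ (d - i) = - ((- 1) ^ (d - Suc i) :: real)"
      using i by (simp add: Suc_diff_Suc[symmetric])
    finally show "poly (jensen_poly d n) (a i) * poly (jensen_poly d n) (a (Suc i)) < 0"
      by (cases "even (d - Suc i)") simp_all
  qed
  then obtain y where y: "\<And>i. i < d \<Longrightarrow> poly (jensen_poly d n) (y i) = 0"
    and y_mono: "\<And>i j. i < j \<Longrightarrow> j < d \<Longrightarrow> y i < y j"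
    by blast
  have "inj_on y {..<d}"
    by (rule linorder_inj_onI) (use y_mono in \<open>force+\<close>)
  with y show ?thesis
    by (intro hyperbolic_if_real_roots[OF jensen_poly_nonzero degree_jensen_poly_le]) blast+
qed

theorem theorem1p3:
  fixes d :: nat
  assumes "0 < d"
  shows "hyperbolicity_bound d \<le> (3 * d) ^ (24 * d) * (50 * d) ^ (3 * d\<^sup>2)"
  unfolding hyperbolicity_bound_def
proof (rule Least_le, intro conjI allI impI)
  show "0 < (3 * d) ^ (24 * d) * (50 * d) ^ (3 * d\<^sup>2)"
    using assms by simp
  show "hyperbolic (jensen_poly d n)" if "(3 * d) ^ (24 * d) * (50 * d) ^ (3 * d\<^sup>2) \<le> n" for n
  proof (cases "d = 1")
    case True
    then show ?thesis
      using hyperbolic_jensen_poly_1 by simp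
  next
    case False
    with assms that show ?thesis
      by (intro hyperbolic_jensen_poly) auto
  qed
qed

end
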